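(* The radical (maximal solvable ideal) of the Lie algebra $L_0$ is spanned as a $k$-vector space by the following elements of $L_0$, where $\bar\alpha=\{\alpha_1,\dots,\alpha_n\}$ runs over all classes of parallel arrows of $Q$: (1) $\sum_{\alpha_i\in S}(\alpha_i,\alpha_i)$ for every equivalence class $S\in\bar\alpha/\!\approx$; (2) $(\alpha_i,\alpha_j)$ for $i\neq j$ whenever $(\alpha_i,\alpha_j)\in L_0$ and $(\alpha_j,\alpha_i)\notin L_0$ (i.e. $\alpha_j\le_{\langle Z\rangle}\alpha_i$ but not $\alpha_i\le_{\langle Z\rangle}\alpha_j$); (3) if $\operatorname{char}k=2$: $(\alpha_{i_1},\alpha_{i_2})$, $(\alpha_{i_2},\alpha_{i_1})$ and $(\alpha_{i_1},\alpha_{i_1})$ for every class $S=\{\alpha_{i_1},\alpha_{i_2}\}\in\bar\alpha/\!\approx$ with exactly two elements.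
   Context: Let $k$ be an algebraically closed field and $Q$ a finite connected quiver; $Q_n$ = paths of length $n$ ($Q_0$ vertices, $Q_1$ arrows), $s,t$ = source, terminus. Let $Z$ be a minimal set of paths of length $\ge2$ (no proper subpath of an element of $Z$ lies in $Z$) with $\Lambda=kQ/\langle Z\rangle$ finite dimensional; $B$ = paths (vertices included) not containing an element of $Z$ as subpath, $B_n=B\cap Q_n$. Paths are parallel if they have the same source and terminus; $X//Y$ = pairs of parallel paths in $X\times Y$, $k(X//Y)$ the vector space with that basis. For a path $\varepsilon$ and $(a,\gamma)\in Q_1//B$, $\varepsilon^{(a,\gamma)}$ = sum of all paths in $B$ obtained by replacing one occurrence of $a$ in $\varepsilon$ by $\gamma$ ($0$ if none); $(\eta,\varepsilon^{(a,\gamma)})=\sum_i(\eta,\varepsilon_i)$ if $\varepsilon^{(a,\gamma)}=\sum_i\varepsilon_i$. $\psi_0:k(Q_0//B)\to k(Q_1//B)$, $(e,\gamma)\mapsto\sum_{a\in Q_1,\,s(a)=e,\,a\gamma\in B}(a,a\gamma)-\sum_{a\in Q_1,\,t(a)=e,\,\gamma a\in B}(a,\gamma a)$; $\psi_1:k(Q_1//B)\to k(Z//B)$, $(a,\gamma)\mapsto\sum_{p\in Z}(p,p^{(a,\gamma)})$. With the bracket $[(a,\gamma),(b,\varepsilon)]=(b,\varepsilon^{(a,\gamma)})-(a,\gamma^{(b,\varepsilon)})$, $\operatorname{Ker}\psi_1$ is a Lie algebra, $\operatorname{Im}\psi_0$ an ideal, and $\operatorname{Ker}\psi_1/\operatorname{Im}\psi_0\cong\operatorname{H}^1(\Lambda,\Lambda)$.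 $L_0$ is the Lie subalgebra of $\operatorname{Ker}\psi_1/\operatorname{Im}\psi_0$ formed by the classes of elements of $k(Q_1//Q_1)\cap\operatorname{Ker}\psi_1$; for $(a,b)\in Q_1//Q_1$ we say $(a,b)\in L_0$ if $(a,b)\in\operatorname{Ker}\psi_1$ and then also write $(a,b)$ for its class; its bracket is $[(a,c),(b,d)]=\delta_{a,d}(b,c)-\delta_{b,c}(a,d)$. For parallel arrows $a,b$ write $a\le_{\langle Z\rangle}b$ if $p^{(b,a)}=0$ for every $p\in Z$ (equivalently $(b,a)\in L_0$). Parallelism is an equivalence relation on $Q_1$; its classes are the classes of parallel arrows. On each class $\bar\alpha$, $a\approx b$ means $a\le_{\langle Z\rangle}b$ and $b\le_{\langle Z\rangle}a$; $\bar\alpha/\!\approx$ is the set of its equivalence classes. *)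

theory Defs
  imports Main "HOL-Computational_Algebra.Polynomial"
begin

section \<open>Generic Lie algebras given by carrier and operations\<close>

record ('k, 'x) lie_alg =
  lcarrier :: "'x set"
  lzero :: 'x
  ladd :: "'x \<Rightarrow> 'x \<Rightarrow> 'x"
  lscale :: "'k \<Rightarrow> 'x \<Rightarrow> 'x"
  lbr :: "'x \<Rightarrow> 'x \<Rightarrow> 'x"

text \<open>Linear span (all finite linear combinations) of a set S.\<close>
inductive_set lspan :: "('k, 'x) lie_alg \<Rightarrow> 'x set \<Rightarrow> 'x set"
  for L :: "('k, 'x) lie_alg" and S :: "'x set" where
  zero: "lzero L \<in> lspan L S"
| step: "x \<in> S \<Longrightarrow> y \<in> lspan L S \<Longrightarrow> ladd L (lscale L c x) y \<in> lspan L S"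

definition lsubspace :: "('k, 'x) lie_alg \<Rightarrow> 'x set \<Rightarrow> bool" where
  "lsubspace L I \<longleftrightarrow> I \<subseteq> lcarrier L \<and> lzero L \<in> I \<and>
     (\<forall>x\<in>I. \<forall>y\<in>I. ladd L x y \<in> I) \<and> (\<forall>c. \<forall>x\<in>I. lscale L c x \<in> I)"

definition lideal :: "('k, 'x) lie_alg \<Rightarrow> 'x set \<Rightarrow> bool" where
  "lideal L I \<longleftrightarrow> lsubspace L I \<and> (\<forall>x\<in>lcarrier L. \<forall>y\<in>I. lbr L x y \<in> I)"

text \<open>Derived series: \<open>I^(0) = I\<close>, \<open>I^(n+1) = [I^(n), I^(n)]\<close>.\<close>
fun lderived :: "('k, 'x) lie_alg \<Rightarrow> 'x set \<Rightarrow> nat \<Rightarrow> 'x set" where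
  "lderived L I 0 = I"
| "lderived L I (Suc n) =
     lspan L {lbr L x y | x y. x \<in> lderived L I n \<and> y \<in> lderived L I n}"

definition lsolvable :: "('k, 'x) lie_alg \<Rightarrow> 'x set \<Rightarrow> bool" where
  "lsolvable L I \<longleftrightarrow> (\<exists>n. lderived L I n = {lzero L})"

text \<open>\<open>R\<close> is the radical: a solvable ideal containing every solvable ideal
  (i.e. the maximal solvable ideal).\<close>
definition lradical :: "('k, 'x) lie_alg \<Rightarrow> 'x set \<Rightarrow> bool" where
  "lradical L R \<longleftrightarrow> lideal L R \<and> lsolvable L R \<and>
     (\<forall>J. lideal L J \<and> lsolvable L J \<longrightarrow> J \<subseteq> R)"

section \<open>Quivers and paths\<close>

record ('v, 'a) quiver =
  verts :: "'v set"
  arrs :: "'a set"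
  src :: "'a \<Rightarrow> 'v"
  tgt :: "'a \<Rightarrow> 'v"

definition finite_quiver :: "('v, 'a) quiver \<Rightarrow> bool" where
  "finite_quiver Q \<longleftrightarrow> finite (verts Q) \<and> finite (arrs Q) \<and>
     src Q ` arrs Q \<subseteq> verts Q \<and> tgt Q ` arrs Q \<subseteq> verts Q"

definition connected_quiver :: "('v, 'a) quiver \<Rightarrow> bool" where
  "connected_quiver Q \<longleftrightarrow> verts Q \<noteq> {} \<and>
     (\<forall>u\<in>verts Q. \<forall>v\<in>verts Q. (u, v) \<in>
        ({(src Q a, tgt Q a) | a. a \<in> arrs Q} \<union> {(tgt Q a, src Q a) | a. a \<in> arrs Q})\<^sup>*)"

text \<open>A path is a pair (source vertex, list of arrows in the order they are traversed);
  a path of length 0 is a vertex.  (The paper writes concatenation right-to-left: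
  \<open>a\<gamma>\<close> means first \<open>\<gamma>\<close> then \<open>a\<close>.)\<close>
type_synonym ('v, 'a) qpath = "'v \<times> 'a list"

definition is_path :: "('v, 'a) quiver \<Rightarrow> ('v, 'a) qpath \<Rightarrow> bool" where
  "is_path Q p \<longleftrightarrow> fst p \<in> verts Q \<and> set (snd p) \<subseteq> arrs Q \<and>
     (snd p \<noteq> [] \<longrightarrow> src Q (hd (snd p)) = fst p) \<and>
     (\<forall>i. Suc i < length (snd p) \<longrightarrow> tgt Q (snd p ! i) = src Q (snd p ! Suc i))"

definition pterm :: "('v, 'a) quiver \<Rightarrow> ('v, 'a) qpath \<Rightarrow> 'v" where
  "pterm Q p = (if snd p = [] then fst p else tgt Q (last (snd p)))"

definition parallel :: "('v, 'a) quiver \<Rightarrow> ('v, 'a) qpath \<Rightarrow> ('v, 'a) qpath \<Rightarrow> bool" where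
  "parallel Q p q \<longleftrightarrow> fst p = fst q \<and> pterm Q p = pterm Q q"

definition arrow_path :: "('v, 'a) quiver \<Rightarrow> 'a \<Rightarrow> ('v, 'a) qpath" where
  "arrow_path Q a = (src Q a, [a])"

text \<open>\<open>p'\<close> is a subpath of \<open>p\<close>.\<close>
definition subpath :: "('v, 'a) quiver \<Rightarrow> ('v, 'a) qpath \<Rightarrow> ('v, 'a) qpath \<Rightarrow> bool" where
  "subpath Q p' p \<longleftrightarrow> (\<exists>xs ys. snd p = xs @ snd p' @ ys \<and> fst p' = pterm Q (fst p, xs))"

text \<open>\<open>Z\<close>: a minimal set of paths of length at least 2.\<close>
definition minimal_relations :: "('v, 'a) quiver \<Rightarrow> ('v, 'a) qpath set \<Rightarrow> bool" where
  "minimal_relations Q Z \<longleftrightarrow>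
     (\<forall>p\<in>Z. is_path Q p \<and> 2 \<le> length (snd p)) \<and>
     (\<forall>p\<in>Z. \<forall>p'\<in>Z. subpath Q p' p \<longrightarrow> p' = p)"

text \<open>\<open>B\<close>: paths (vertices included) not containing an element of \<open>Z\<close> as subpath.\<close>
definition Bpaths :: "('v, 'a) quiver \<Rightarrow> ('v, 'a) qpath set \<Rightarrow> ('v, 'a) qpath set" where
  "Bpaths Q Z = {p. is_path Q p \<and> \<not> (\<exists>z\<in>Z. subpath Q z p)}"

text \<open>Replace the arrow at position \<open>i\<close> of \<open>p\<close> by the path \<open>\<gamma>\<close>.\<close>
definition repl :: "('v, 'a) qpath \<Rightarrow> nat \<Rightarrow> ('v, 'a) qpath \<Rightarrow> ('v, 'a) qpath" where
  "repl p i \<gamma> = (fst p, take i (snd p) @ snd \<gamma> @ drop (Suc i) (snd p))"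

text \<open>Coefficient of the path \<open>q\<close> in \<open>\<epsilon>^(a,\<gamma>)\<close> (number of occurrences of \<open>a\<close> in \<open>\<epsilon>\<close>
  whose replacement by \<open>\<gamma>\<close> yields \<open>q\<close>, provided \<open>q \<in> B\<close>).\<close>
definition occ_count :: "('v, 'a) quiver \<Rightarrow> ('v, 'a) qpath set \<Rightarrow>
    ('v, 'a) qpath \<Rightarrow> 'a \<Rightarrow> ('v, 'a) qpath \<Rightarrow> ('v, 'a) qpath \<Rightarrow> nat" where
  "occ_count Q Z \<epsilon> a \<gamma> q =
     (if q \<in> Bpaths Q Z
      then card {i. i < length (snd \<epsilon>) \<and> snd \<epsilon> ! i = a \<and> repl \<epsilon> i \<gamma> = q} else 0)"

section \<open>The complex \<open>k(Q_0//B) \<rightarrow> k(Q_1//B) \<rightarrow> k(Z//B)\<close>\<close>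

text \<open>Elements of \<open>k(X//Y)\<close> are represented as coefficient functions on pairs.\<close>

definition Q0B :: "('v, 'a) quiver \<Rightarrow> ('v, 'a) qpath set \<Rightarrow> ('v \<times> ('v, 'a) qpath) set" where
  "Q0B Q Z = {(e, \<gamma>). e \<in> verts Q \<and> \<gamma> \<in> Bpaths Q Z \<and> parallel Q (e, []) \<gamma>}"

definition Q1B :: "('v, 'a) quiver \<Rightarrow> ('v, 'a) qpath set \<Rightarrow> ('a \<times> ('v, 'a) qpath) set" where
  "Q1B Q Z = {(a, \<gamma>). a \<in> arrs Q \<and> \<gamma> \<in> Bpaths Q Z \<and> parallel Q (arrow_path Q a) \<gamma>}"

definition Q1Q1 :: "('v, 'a) quiver \<Rightarrow> ('a \<times> ('v, 'a) qpath) set" where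
  "Q1Q1 Q = {(a, arrow_path Q b) | a b. a \<in> arrs Q \<and> b \<in> arrs Q \<and>
                 parallel Q (arrow_path Q a) (arrow_path Q b)}"

text \<open>\<open>k(Q_1//B)\<close>\<close>
definition C1 :: "('v, 'a) quiver \<Rightarrow> ('v, 'a) qpath set \<Rightarrow> ('a \<times> ('v, 'a) qpath \<Rightarrow> 'k::field) set" where
  "C1 Q Z = {f. \<forall>x. f x \<noteq> 0 \<longrightarrow> x \<in> Q1B Q Z}"

definition basis_el :: "'x \<Rightarrow> 'x \<Rightarrow> 'k::field" where
  "basis_el y = (\<lambda>x. if x = y then 1 else 0)"

definition psi0_basis :: "('v, 'a) quiver \<Rightarrow> ('v, 'a) qpath set \<Rightarrow>
    'v \<times> ('v, 'a) qpath \<Rightarrow> 'a \<times> ('v, 'a) qpath \<Rightarrow> 'k::field" where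
  "psi0_basis Q Z g = (case g of (e, \<gamma>) \<Rightarrow>
     (\<lambda>x. (\<Sum>a\<in>{a \<in> arrs Q. src Q a = e}.
              if (e, snd \<gamma> @ [a]) \<in> Bpaths Q Z \<and> x = (a, (e, snd \<gamma> @ [a])) then 1 else 0)
        - (\<Sum>a\<in>{a \<in> arrs Q. tgt Q a = e}.
              if (src Q a, a # snd \<gamma>) \<in> Bpaths Q Z \<and> x = (a, (src Q a, a # snd \<gamma>)) then 1 else 0)))"

definition ImPsi0 :: "('v, 'a) quiver \<Rightarrow> ('v, 'a) qpath set \<Rightarrow> ('a \<times> ('v, 'a) qpath \<Rightarrow> 'k::field) set" where
  "ImPsi0 Q Z = {f. \<exists>c. f = (\<lambda>x. \<Sum>g\<in>Q0B Q Z. c g * psi0_basis Q Z g x)}"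

definition psi1 :: "('v, 'a) quiver \<Rightarrow> ('v, 'a) qpath set \<Rightarrow>
    ('a \<times> ('v, 'a) qpath \<Rightarrow> 'k::field) \<Rightarrow> ('v, 'a) qpath \<times> ('v, 'a) qpath \<Rightarrow> 'k" where
  "psi1 Q Z f = (\<lambda>(p, q). if p \<in> Z
      then (\<Sum>u\<in>Q1B Q Z. f u * of_nat (occ_count Q Z p (fst u) (snd u) q)) else 0)"

definition KerPsi1 :: "('v, 'a) quiver \<Rightarrow> ('v, 'a) qpath set \<Rightarrow> ('a \<times> ('v, 'a) qpath \<Rightarrow> 'k::field) set" where
  "KerPsi1 Q Z = {f \<in> C1 Q Z. psi1 Q Z f = (\<lambda>_. 0)}"

text \<open>Bilinear extension of \<open>[(a,\<gamma>),(b,\<epsilon>)] = (b,\<epsilon>^(a,\<gamma>)) - (a,\<gamma>^(b,\<epsilon>))\<close>.\<close>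
definition bracket1 :: "('v, 'a) quiver \<Rightarrow> ('v, 'a) qpath set \<Rightarrow>
    ('a \<times> ('v, 'a) qpath \<Rightarrow> 'k::field) \<Rightarrow> ('a \<times> ('v, 'a) qpath \<Rightarrow> 'k) \<Rightarrow>
    'a \<times> ('v, 'a) qpath \<Rightarrow> 'k" where
  "bracket1 Q Z f g = (\<lambda>(x, q). \<Sum>u\<in>Q1B Q Z. \<Sum>v\<in>Q1B Q Z. f u * g v *
      ((if x = fst v then of_nat (occ_count Q Z (snd v) (fst u) (snd u) q) else 0)
     - (if x = fst u then of_nat (occ_count Q Z (snd u) (fst v) (snd v) q) else 0)))"

section \<open>The Lie algebra \<open>L_0 \<subseteq> Ker \<psi>_1 / Im \<psi>_0\<close>\<close>

definition coset :: "('x \<Rightarrow> 'k::field) set \<Rightarrow> ('x \<Rightarrow> 'k) \<Rightarrow> ('x \<Rightarrow> 'k) set" where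
  "coset W f = {(\<lambda>x. f x + w x) | w. w \<in> W}"

text \<open>Elements of \<open>k(Q_1//Q_1) \<inter> Ker \<psi>_1\<close>.\<close>
definition V0 :: "('v, 'a) quiver \<Rightarrow> ('v, 'a) qpath set \<Rightarrow> ('a \<times> ('v, 'a) qpath \<Rightarrow> 'k::field) set" where
  "V0 Q Z = {f \<in> KerPsi1 Q Z. \<forall>x. f x \<noteq> 0 \<longrightarrow> x \<in> Q1Q1 Q}"

text \<open>\<open>L_0\<close>: the classes modulo \<open>Im \<psi>_0\<close> of the elements of \<open>V0\<close>, with the operations
  of the quotient Lie algebra \<open>Ker \<psi>_1 / Im \<psi>_0\<close> (on cosets).\<close>
definition L0 :: "('v, 'a) quiver \<Rightarrow> ('v, 'a) qpath set \<Rightarrow>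
    ('k::field, ('a \<times> ('v, 'a) qpath \<Rightarrow> 'k) set) lie_alg" where
  "L0 Q Z = \<lparr>
     lcarrier = {coset (ImPsi0 Q Z) f | f. f \<in> V0 Q Z},
     lzero = ImPsi0 Q Z,
     ladd = (\<lambda>X Y. {(\<lambda>x. f x + g x) | f g. f \<in> X \<and> g \<in> Y}),
     lscale = (\<lambda>c X. {(\<lambda>x. c * f x + w x) | f w. f \<in> X \<and> w \<in> ImPsi0 Q Z}),
     lbr = (\<lambda>X Y. {(\<lambda>x. bracket1 Q Z f g x + w x) | f g w.
                    f \<in> X \<and> g \<in> Y \<and> w \<in> ImPsi0 Q Z}) \<rparr>"

text \<open>The class in \<open>L_0\<close> of the basis element \<open>(a,b)\<close>, \<open>a, b\<close> parallel arrows.\<close>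
definition cls_el :: "('v, 'a) quiver \<Rightarrow> ('v, 'a) qpath set \<Rightarrow> 'a \<Rightarrow> 'a \<Rightarrow>
    ('a \<times> ('v, 'a) qpath \<Rightarrow> 'k::field) set" where
  "cls_el Q Z a b = coset (ImPsi0 Q Z) (basis_el (a, arrow_path Q b))"

text \<open>\<open>(a,b) \<in> L_0\<close>: \<open>(a,b) \<in> Ker \<psi>_1\<close>.\<close>
definition inL0 :: "'k::field itself \<Rightarrow> ('v, 'a) quiver \<Rightarrow> ('v, 'a) qpath set \<Rightarrow> 'a \<Rightarrow> 'a \<Rightarrow> bool" where
  "inL0 _ Q Z a b \<longleftrightarrow>
     psi1 Q Z (basis_el (a, arrow_path Q b) :: _ \<Rightarrow> 'k) = (\<lambda>_. 0)"

text \<open>\<open>a \<le>_<Z> b\<close>: \<open>p^(b,a) = 0\<close> in \<open>k B\<close> for every \<open>p \<in> Z\<close>.\<close>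
definition leZ :: "'k::field itself \<Rightarrow> ('v, 'a) quiver \<Rightarrow> ('v, 'a) qpath set \<Rightarrow> 'a \<Rightarrow> 'a \<Rightarrow> bool" where
  "leZ _ Q Z a b \<longleftrightarrow>
     (\<forall>p\<in>Z. \<forall>q. (of_nat (occ_count Q Z p b (arrow_path Q a) q) :: 'k) = 0)"

text \<open>The \<open>\<approx>\<close>-class of an arrow \<open>a\<close> inside its class of parallel arrows.\<close>
definition approx_cls :: "'k::field itself \<Rightarrow> ('v, 'a) quiver \<Rightarrow> ('v, 'a) qpath set \<Rightarrow> 'a \<Rightarrow> 'a set" where
  "approx_cls K Q Z a = {b \<in> arrs Q. parallel Q (arrow_path Q b) (arrow_path Q a) \<and>
                            leZ K Q Z a b \<and> leZ K Q Z b a}"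

text \<open>The spanning elements (1), (2), (3) of the statement.\<close>
definition rad_gens :: "('v, 'a) quiver \<Rightarrow> ('v, 'a) qpath set \<Rightarrow>
    ('a \<times> ('v, 'a) qpath \<Rightarrow> 'k::field) set set" where
  "rad_gens Q Z =
     {coset (ImPsi0 Q Z) (\<lambda>x. \<Sum>b\<in>approx_cls TYPE('k) Q Z a. basis_el (b, arrow_path Q b) x)
        | a. a \<in> arrs Q}
   \<union> {cls_el Q Z ai aj | ai aj. ai \<in> arrs Q \<and> aj \<in> arrs Q \<and> ai \<noteq> aj \<and>
        parallel Q (arrow_path Q ai) (arrow_path Q aj) \<and>
        inL0 TYPE('k) Q Z ai aj \<and> \<not> inL0 TYPE('k) Q Z aj ai}
   \<union> (if CHAR('k) = 2 then
        {cls_el Q Z a b | a b. a \<in> arrs Q \<and> b \<in> arrs Q \<and> a \<noteq> b \<and>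
           approx_cls TYPE('k) Q Z a = {a, b}}
      \<union> {cls_el Q Z a a | a b. a \<in> arrs Q \<and> b \<in> arrs Q \<and> a \<noteq> b \<and>
           approx_cls TYPE('k) Q Z a = {a, b}}
      else {})"

end

theory Submission
  imports Defs
begin

text \<open>
  A pair \<open>(a, b)\<close> of parallel arrows behaves like the matrix unit \<open>E\<^sub>b\<^sub>a\<close>, and \<open>(a, b)\<close> lies in
  \<open>Ker \<psi>\<^sub>1\<close> iff \<open>b \<le>\<^sub>\<langle>\<^sub>Z\<^sub>\<rangle> a\<close>, which is a preorder. Hence \<open>k(Q\<^sub>1//Q\<^sub>1) \<inter> Ker \<psi>\<^sub>1\<close> is the Lie algebra of
  the matrices supported on this preorder. Elements of \<open>Ker \<psi>\<^sub>1\<close> are derivations of \<open>kQ/\<langle>Z\<rangle>\<close> and those of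
  \<open>Im \<psi>\<^sub>0\<close> are inner ones, so \<open>Im \<psi>\<^sub>0\<close> is an ideal; it meets the matrices in diagonal ones that are
  constant on each class of parallel arrows, which are central.

  The matrices supported strictly above the equivalence classes, the block scalars, and the
  \<open>2 \<times> 2\<close> blocks in characteristic 2 (where \<open>gl\<^sub>2\<close> is solvable) form a solvable ideal. Conversely, let an
  ideal contain a matrix with a non-scalar block of another kind. Then its image in that block contains
  all off-diagonal matrix units, and these survive in the whole derived series.
\<close>

section \<open>Incidence Lie algebras modulo block scalars\<close>

text \<open>In characteristic 2 the derived algebra of gl_2 is spanned by E_12, E_21 and E_11 - E_22
  = I. As I is central, this is a Heisenberg algebra, and gl_2 vanishes after three steps. On any
  other block with at least two elements the off-diagonal units reproduce themselves, by E_uv =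
  [E_uk, E_kv] if there is a third index k, or by 2 E_uv = [E_uu - E_vv, E_uv] if 2 is invertible.
  This alternative is what the exceptional case lacks.

  The obstacle on the quiver side is that \<open>L0\<close> consists of cosets with set-wise
  operations: the bracket of two classes is again one coset only because the image of psi_0 is an
  ideal. The defining formulas count occurrences of arrows, which hides this. Once the counts are
  rewritten as derivations, it is the identity [ad W, D] = - ad (D W). No algebra structure is built
  for this; products p F r with fixed outer paths p, r suffice.\<close>

type_synonym ('a, 'k) mat = "'a \<Rightarrow> 'a \<Rightarrow> 'k"

definition unit_mat :: "'a \<Rightarrow> 'a \<Rightarrow> ('a, 'k::field) mat" where
  "unit_mat i j = (\<lambda>p q. if p = i \<and> q = j then 1 else 0)"

definition mat_comm :: "'a set \<Rightarrow> ('a, 'k::field) mat \<Rightarrow> ('a, 'k) mat \<Rightarrow> ('a, 'k) mat" where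
  "mat_comm A M N = (\<lambda>i j. (\<Sum>k\<in>A. M i k * N k j) - (\<Sum>k\<in>A. N i k * M k j))"

definition supported :: "('a \<Rightarrow> 'a \<Rightarrow> bool) \<Rightarrow> ('a, 'k::field) mat set" where
  "supported R = {M. \<forall>i j. M i j \<noteq> 0 \<longrightarrow> R i j}"

definition block :: "('a \<Rightarrow> 'a \<Rightarrow> bool) \<Rightarrow> 'a \<Rightarrow> 'a set" where
  "block R i = {j. R i j \<and> R j i}"

text \<open>Abstracts L_0: \<open>c\<close> sends a matrix to its class, and \<open>R i j\<close>
  says that the entry in row \<open>i\<close> and column \<open>j\<close> may be nonzero.
  \<open>c\<close> is not assumed injective; \<open>kernel\<close> records what a matrix of zero
  class must look like, without describing the kernel exactly.\<close>

locale incidence_quotient =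
  fixes L :: "('k::field, 'x) lie_alg" and A :: "'a set" and R :: "'a \<Rightarrow> 'a \<Rightarrow> bool"
    and c :: "('a, 'k) mat \<Rightarrow> 'x"
  assumes finA: "finite A"
    and R_in: "R i j \<Longrightarrow> i \<in> A \<and> j \<in> A"
    and R_refl: "i \<in> A \<Longrightarrow> R i i"
    and R_trans: "R i j \<Longrightarrow> R j l \<Longrightarrow> R i l"
    and carrier_eq: "lcarrier L = c ` supported R"
    and zero_eq: "lzero L = c (\<lambda>_ _. 0)"
    and add_eq: "M \<in> supported R \<Longrightarrow> N \<in> supported R \<Longrightarrow>
        ladd L (c M) (c N) = c (\<lambda>i j. M i j + N i j)"
    and scale_eq: "M \<in> supported R \<Longrightarrow> lscale L s (c M) = c (\<lambda>i j. s * M i j)"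
    and br_eq: "M \<in> supported R \<Longrightarrow> N \<in> supported R \<Longrightarrow> lbr L (c M) (c N) = c (mat_comm A M N)"
    and kernel: "M \<in> supported R \<Longrightarrow> c M = lzero L \<Longrightarrow>
        (\<forall>i j. i \<noteq> j \<longrightarrow> M i j = 0) \<and> (\<forall>i j. R i j \<longrightarrow> M i i = M j j)"
begin

text \<open>The blocks whose full matrix algebra is solvable although not all of it is scalar.
  One-element blocks are left out because there every matrix is scalar.\<close>

definition exceptional :: "'a \<Rightarrow> bool" where
  "exceptional i \<longleftrightarrow> CHAR('k) = 2 \<and> card (block R i) = 2"

text \<open>Families (1), (2), (3) of the theorem under a transposed dictionary:
  \<open>unit_mat i j\<close> is the pair with first arrow \<open>j\<close> and second arrow
  \<open>i\<close>. The last family includes \<open>j = i\<close>, so it contains all four units of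
  an exceptional block.\<close>

definition gens :: "('a, 'k) mat set" where
  "gens = {(\<lambda>p q. \<Sum>b\<in>block R a. unit_mat b b p q) | a. a \<in> A}
    \<union> {unit_mat i j | i j. R i j \<and> \<not> R j i}
    \<union> {unit_mat i j | i j. exceptional i \<and> j \<in> block R i}"

text \<open>Entrywise form of the span of \<open>gens\<close>. A supported matrix outside it
  directly yields two indices of an ordinary block with a nonzero entry between them or with unequal
  diagonal entries, which is where the maximality argument starts.\<close>

definition rad :: "('a, 'k) mat set" where
  "rad = {M \<in> supported R. \<forall>i. \<not> exceptional i \<longrightarrow>
     (\<forall>j \<in> block R i. M i i = M j j \<and> (i \<noteq> j \<longrightarrow> M i j = 0))}"

lemma in_suppI: "(\<And>i j. \<not> R i j \<Longrightarrow> M i j = 0) \<Longrightarrow> M \<in> supported R"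
  unfolding supported_def by blast

lemma suppD: "M \<in> supported R \<Longrightarrow> \<not> R i j \<Longrightarrow> M i j = 0"
  unfolding supported_def by blast

lemma supp_zero: "(\<lambda>_ _. 0 :: 'k) \<in> supported R"
  and supp_add: "M \<in> supported R \<Longrightarrow> N \<in> supported R \<Longrightarrow> (\<lambda>i j. M i j + N i j :: 'k) \<in> supported R"
  and supp_scale: "M \<in> supported R \<Longrightarrow> (\<lambda>i j. s * M i j :: 'k) \<in> supported R"
  and supp_unit: "R i j \<Longrightarrow> (unit_mat i j :: ('a, 'k) mat) \<in> supported R"
     apply (rule in_suppI; simp)
    apply (rule in_suppI; simp add: suppD)
   apply (rule in_suppI; simp add: suppD)
  apply (rule in_suppI; auto simp: unit_mat_def)
  done

lemma sum_supp_zero: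
  assumes "M \<in> supported R" "N \<in> supported R" "\<not> R i j"
  shows "(\<Sum>k\<in>A. M i k * N k j) = (0::'k)"
proof (rule sum.neutral, rule ballI)
  fix k show "M i k * N k j = 0"
    using assms R_trans[of i k j] suppD[of M i k] suppD[of N k j] by auto
qed

lemma supp_comm: "M \<in> supported R \<Longrightarrow> N \<in> supported R \<Longrightarrow> (mat_comm A M N :: ('a, 'k) mat) \<in> supported R"
  by (rule in_suppI) (simp add: mat_comm_def sum_supp_zero)

lemma block_eq: "j \<in> block R i \<Longrightarrow> block R j = block R i"
  unfolding block_def using R_trans by blast

lemma block_in: "block R i \<subseteq> A"
  unfolding block_def using R_in by blast

lemma block_sym: "j \<in> block R i \<Longrightarrow> i \<in> block R j"
  unfolding block_def by blast

lemma block_self: "i \<in> A \<Longrightarrow> i \<in> block R i"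
  unfolding block_def using R_refl by blast

lemma fin_block: "finite (block R i)"
  using block_in finA finite_subset by blast

lemma exceptional_block: "j \<in> block R i \<Longrightarrow> exceptional j = exceptional i"
  unfolding exceptional_def using block_eq by simp

text \<open>If \<open>i\<close> and \<open>j\<close> are equivalent, then \<open>R i k\<close> and
  \<open>R k j\<close> force \<open>k\<close> into the same class, so no nonzero product leaves the
  block.\<close>

lemma sum_block:
  assumes "M \<in> supported R" "N \<in> supported R" "i \<in> block R a" "j \<in> block R a"
  shows "(\<Sum>k\<in>A. M i k * N k j) = (\<Sum>k\<in>block R a. M i k * N k j :: 'k)"
proof (rule sum.mono_neutral_right[OF finA block_in], rule ballI)
  fix k assume k: "k \<in> A - block R a"
  have "\<not> (R i k \<and> R k j)"
    using k assms(3,4) R_trans unfolding block_def by blast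
  then show "M i k * N k j = 0" using suppD[OF assms(1)] suppD[OF assms(2)] by auto
qed

text \<open>Restriction to a diagonal block is a Lie algebra homomorphism; the arguments about a
  single block rest on this.\<close>

lemma comm_block:
  fixes M N :: "('a, 'k) mat"
  assumes "M \<in> supported R" "N \<in> supported R" "i \<in> block R a" "j \<in> block R a"
  shows "mat_comm A M N i j = mat_comm (block R a) M N i j"
  using sum_block[OF assms] sum_block[OF assms(2,1,3,4)] by (simp add: mat_comm_def)

section \<open>The candidate radical and its spanning set\<close>

lemma rad_supp: "M \<in> rad \<Longrightarrow> M \<in> supported R" by (simp add: rad_def)

lemma rad_zero: "(\<lambda>_ _. 0) \<in> rad"
  using supp_zero by (simp add: rad_def)

lemma rad_add: "M \<in> rad \<Longrightarrow> N \<in> rad \<Longrightarrow> (\<lambda>i j. M i j + N i j) \<in> rad"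
  using supp_add by (auto simp: rad_def)

lemma rad_scale: "M \<in> rad \<Longrightarrow> (\<lambda>i j. s * M i j) \<in> rad"
  using supp_scale by (auto simp: rad_def)

lemma unit_strict_rad: "R i j \<Longrightarrow> \<not> R j i \<Longrightarrow> unit_mat i j \<in> rad"
  using supp_unit[of i j] R_refl R_in
  by (fastforce simp: rad_def unit_mat_def block_def)

lemma unit_exc_rad:
  assumes "exceptional i" "j \<in> block R i" shows "unit_mat i j \<in> rad"
proof -
  have R: "R i j" using assms(2) by (simp add: block_def)
  have "exceptional j" using exceptional_block[OF assms(2)] assms(1) by simp
  moreover have "l \<noteq> i" if "\<not> exceptional k" "l \<in> block R k" for k l
    using that exceptional_block assms(1) by metis
  ultimately show ?thesis
    using supp_unit[OF R] assms(1) by (auto simp: rad_def unit_mat_def)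
qed

lemma block_id: "(\<lambda>p q. \<Sum>b\<in>block R a. unit_mat b b p q) =
    (\<lambda>p q. if p = q \<and> p \<in> block R a then (1::'k) else 0)"
proof (intro ext)
  fix p q
  have "(\<Sum>b\<in>block R a. unit_mat b b p q :: 'k) = (\<Sum>b\<in>block R a. if b = p then (if p = q then 1 else 0) else 0)"
    by (rule sum.cong) (auto simp: unit_mat_def)
  also have "\<dots> = (if p = q \<and> p \<in> block R a then 1 else 0)" using fin_block by (simp add: sum.delta)
  finally show "(\<Sum>b\<in>block R a. unit_mat b b p q :: 'k) = (if p = q \<and> p \<in> block R a then 1 else 0)" .
qed

lemmas block_id' = fun_cong[OF fun_cong[OF block_id]]

lemma block_id_rad: "(\<lambda>p q. \<Sum>b\<in>block R a. unit_mat b b p q) \<in> rad"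
proof -
  have "j \<in> block R a \<longleftrightarrow> i \<in> block R a" if "j \<in> block R i" for i j
    using that block_eq block_sym by blast
  then show ?thesis unfolding block_id
    using R_refl block_in by (fastforce simp: rad_def supported_def)
qed

lemma gens_rad: "gens \<subseteq> rad"
  using block_id_rad unit_strict_rad unit_exc_rad by (auto simp: gens_def)

lemma lspan_gens_sub: "lspan L (c ` gens) \<subseteq> c ` rad"
proof
  fix x assume "x \<in> lspan L (c ` gens)"
  then show "x \<in> c ` rad"
  proof induction
    case zero then show ?case using rad_zero zero_eq by blast
  next
    case (step x y s)
    then obtain M N where "M \<in> rad" "x = c M" "N \<in> rad" "y = c N" using gens_rad by blast
    moreover from this have "ladd L (lscale L s x) y = c (\<lambda>i j. s * M i j + N i j)"
      by (simp add: scale_eq add_eq rad_supp supp_scale)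
    ultimately show ?case using rad_add[OF rad_scale] by auto
  qed
qed

text \<open>\<open>lspan\<close> adds one scaled generator at a time, so sums are built by induction
  on the index set. The support is carried along because \<open>add_eq\<close> applies to supported
  matrices.\<close>

lemma lspan_finite_sum:
  assumes "finite I" "\<And>t. t \<in> I \<Longrightarrow> G t \<in> gens"
  shows "c (\<lambda>p q. \<Sum>t\<in>I. s t * G t p q) \<in> lspan L (c ` gens) \<and>
    (\<lambda>p q. \<Sum>t\<in>I. s t * G t p q) \<in> supported R"
  using assms
proof (induction I)
  case empty
  then show ?case using lspan.zero[of L] supp_zero by (simp add: zero_eq[symmetric])
next
  case (insert t I)
  have G: "G t \<in> supported R" using insert gens_rad rad_supp by blast
  have "c (\<lambda>p q. \<Sum>t\<in>insert t I. s t * G t p q) =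
      ladd L (lscale L (s t) (c (G t))) (c (\<lambda>p q. \<Sum>t\<in>I. s t * G t p q))"
    using insert G by (simp add: scale_eq add_eq supp_scale)
  then show ?case
    using insert G lspan.step[of "c (G t)" "c ` gens" _ L "s t"]
      supp_add[OF supp_scale[OF G, of "s t"]] by auto
qed

lemma lspan_add:
  assumes "x \<in> lspan L (c ` gens)" "y \<in> lspan L (c ` gens)"
  shows "ladd L x y \<in> lspan L (c ` gens)"
  using assms
proof (induction rule: lspan.induct)
  case zero
  then obtain N where "N \<in> supported R" "y = c N" using lspan_gens_sub rad_supp by blast
  then show ?case using zero supp_zero by (simp add: zero_eq add_eq)
next
  case (step x z s)
  have "x \<in> c ` supported R" "y \<in> c ` supported R" "z \<in> c ` supported R"
    using step lspan_gens_sub rad_supp gens_rad by fast+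
  then obtain X Y Z where *: "X \<in> supported R" "Y \<in> supported R" "Z \<in> supported R"
    "x = c X" "y = c Y" "z = c Z"
    by blast
  have "ladd L (ladd L (lscale L s x) z) y = ladd L (lscale L s x) (ladd L z y)"
    using * by (simp add: scale_eq add_eq supp_scale supp_add add.assoc)
  then show ?case using step lspan.step by metis
qed

lemma finR: "finite {(i, j). R i j}"
  by (rule finite_subset[of _ "A \<times> A"]) (use R_in finA in auto)

text \<open>\<open>M\<close> splits into \<open>U\<close>, the entries strictly above the blocks and
  all entries of exceptional blocks, each with its own matrix unit, and \<open>W\<close>, the
  diagonals of the ordinary blocks, with one scalar per block.\<close>

lemma rad_sub_lspan: "c ` rad \<subseteq> lspan L (c ` gens)"
proof
  fix x assume "x \<in> c ` rad"
  then obtain M where M: "M \<in> rad" "x = c M" by blast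
  let ?I = "{(i, j). R i j \<and> (\<not> R j i \<or> exceptional i)}"
  let ?B = "block R ` {i\<in>A. \<not> exceptional i}"
  define U where "U = (\<lambda>p q. \<Sum>t\<in>?I. M (fst t) (snd t) * unit_mat (fst t) (snd t) p q)"
  \<comment> \<open>The sum in \<open>W\<close> runs over blocks rather than indices, so each block
    identity occurs once; \<open>r S\<close> is an arbitrary member at which the common diagonal
    value is read off.\<close>
  define r where "r S = (SOME i. i \<in> S)" for S :: "'a set"
  define W where "W = (\<lambda>p q. \<Sum>S\<in>?B. M (r S) (r S) * (\<Sum>b\<in>block R (r S). unit_mat b b p q))"
  have finI: "finite ?I" by (rule finite_subset[OF _ finR]) auto
  have finB: "finite ?B" using finA by simp
  have rS: "r S \<in> S \<and> block R (r S) = S \<and> r S \<in> A" if S: "S \<in> ?B" for S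
  proof -
    obtain i where i: "S = block R i" "i \<in> A" using S by blast
    then have "r S \<in> S" unfolding r_def using block_self someI by metis
    then show ?thesis using i block_eq block_in by blast
  qed
  have U: "c U \<in> lspan L (c ` gens) \<and> U \<in> supported R"
    unfolding U_def
  proof (rule lspan_finite_sum[OF finI])
    fix t assume "t \<in> ?I"
    then have "R (fst t) (snd t)" "\<not> R (snd t) (fst t) \<or> exceptional (fst t) \<and> snd t \<in> block R (fst t)"
      by (auto simp: block_def)
    then show "unit_mat (fst t) (snd t) \<in> gens" unfolding gens_def by blast
  qed
  have W: "c W \<in> lspan L (c ` gens) \<and> W \<in> supported R"
    unfolding W_def
  proof (rule lspan_finite_sum[OF finB])
    fix S assume "S \<in> ?B"
    then have "r S \<in> A" using rS by blast
    then show "(\<lambda>p q. \<Sum>b\<in>block R (r S). unit_mat b b p q) \<in> gens" unfolding gens_def by blast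
  qed
  have Upq: "U p q = (if R p q \<and> (\<not> R q p \<or> exceptional p) then M p q else 0)" for p q
  proof -
    have "U p q = (\<Sum>t\<in>?I. if t = (p, q) then M p q else 0)"
      unfolding U_def by (rule sum.cong) (auto simp: unit_mat_def)
    then show ?thesis using finI by (simp add: sum.delta)
  qed
  have Wpq: "W p q = (if p = q \<and> p \<in> A \<and> \<not> exceptional p then M p p else 0)" for p q
  proof (cases "p = q \<and> p \<in> A \<and> \<not> exceptional p")
    case False
    have "(\<Sum>b\<in>block R (r S). unit_mat b b p q) = (0::'k)" if S: "S \<in> ?B" for S
    proof -
      have "\<not> (p = q \<and> p \<in> S)" using False S exceptional_block block_in by blast
      then show ?thesis unfolding block_id' using rS[OF S] by simp
    qed
    then have "W p q = 0" unfolding W_def by (simp cong: sum.cong)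
    then show ?thesis unfolding if_not_P[OF False] .
  next
    case True
    have "W p q = (\<Sum>S\<in>?B. if S = block R p then M p p else 0)"
      unfolding W_def
    proof (rule sum.cong[OF refl])
      fix S assume S: "S \<in> ?B"
      show "M (r S) (r S) * (\<Sum>b\<in>block R (r S). unit_mat b b p q) = (if S = block R p then M p p else 0)"
      proof (cases "S = block R p")
        case True2: True
        have "r S \<in> block R p" using rS[OF S] True2 by blast
        then have "M p p = M (r S) (r S)" using M(1) True unfolding rad_def by blast
        then show ?thesis unfolding block_id'
          using rS[OF S] True2 True block_self[of p] by auto
      next
        case F: False
        then have "p \<notin> S" using S block_eq by blast
        then show ?thesis unfolding block_id'
          using rS[OF S] F by simp
      qed
    qed
    also have "\<dots> = M p p" unfolding sum.delta[OF finB] using True by auto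
    finally show ?thesis unfolding if_P[OF True] .
  qed
  have "M p q = U p q + W p q" for p q
  proof (cases "R p q")
    case False
    then show ?thesis using suppD[OF rad_supp[OF M(1)]] R_refl by (auto simp: Upq Wpq)
  next
    case True
    then have pA: "p \<in> A" "q \<in> A" using R_in by auto
    show ?thesis
    proof (cases "\<not> R q p \<or> exceptional p")
      case T: True then show ?thesis using True R_refl pA by (auto simp: Upq Wpq)
    next
      case False
      then have "q \<in> block R p" using True by (simp add: block_def)
      then show ?thesis using False M(1) pA by (auto simp: Upq Wpq rad_def)
    qed
  qed
  then have "M = (\<lambda>i j. U i j + W i j)" by blast
  then have "c M = ladd L (c U) (c W)" using U W by (simp add: add_eq)
  then show "x \<in> lspan L (c ` gens)" using lspan_add U W M(2) by simp
qed

lemma lspan_gens: "lspan L (c ` gens) = c ` rad"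
  using rad_sub_lspan lspan_gens_sub by blast

end

section \<open>Commutators with matrix units and with scalar matrices\<close>

lemma mat_comm_unit_left:
  assumes "finite S" "a \<in> S" "b \<in> S"
  shows "mat_comm S (unit_mat a b) X p q = (if p = a then X b q else 0) - (if q = b then X p a else 0)"
proof -
  have "(\<Sum>k\<in>S. unit_mat a b p k * X k q) = (\<Sum>k\<in>S. if k = b then (if p = a then X b q else 0) else 0)"
    by (rule sum.cong) (auto simp: unit_mat_def)
  moreover have "(\<Sum>k\<in>S. X p k * unit_mat a b k q) = (\<Sum>k\<in>S. if k = a then (if q = b then X p a else 0) else 0)"
    by (rule sum.cong) (auto simp: unit_mat_def)
  ultimately show ?thesis using assms by (simp add: mat_comm_def sum.delta)
qed

text \<open>Scalar matrices are central. \<open>N\<close> has to be scalar only on \<open>S\<close>,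
  so the fact applies to one block of a larger matrix.\<close>

lemma mat_comm_scalar:
  assumes "finite S" "i \<in> S" "j \<in> S"
    and "\<And>p q. p \<in> S \<Longrightarrow> q \<in> S \<Longrightarrow> N p q = (if p = q then \<nu> else 0)"
  shows "mat_comm S M N i j = 0"
proof -
  have "(\<Sum>k\<in>S. M i k * N k j) = (\<Sum>k\<in>S. if k = j then M i j * \<nu> else 0)"
    by (rule sum.cong) (use assms in auto)
  moreover have "(\<Sum>k\<in>S. N i k * M k j) = (\<Sum>k\<in>S. if k = i then \<nu> * M i j else 0)"
    by (rule sum.cong) (use assms in auto)
  ultimately show ?thesis using assms by (simp add: mat_comm_def sum.delta)
qed

lemma mat_comm_cong:
  assumes "\<And>p q. p \<in> S \<Longrightarrow> q \<in> S \<Longrightarrow> M p q = M' p q"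
    and "\<And>p q. p \<in> S \<Longrightarrow> q \<in> S \<Longrightarrow> N p q = N' p q" and "i \<in> S" "j \<in> S"
  shows "mat_comm S M N i j = mat_comm S M' N' i j"
  using assms by (simp add: mat_comm_def cong: sum.cong)

section \<open>The candidate is a solvable ideal\<close>

context incidence_quotient
begin

text \<open>On an ordinary block \<open>N\<close> is scalar, so the commutator vanishes there;
  exceptional blocks impose no condition.\<close>

lemma rad_ideal:
  assumes M: "M \<in> supported R" and N: "N \<in> rad"
  shows "mat_comm A M N \<in> rad"
proof -
  note N' = rad_supp[OF N]
  have *: "mat_comm A M N p q = 0"
    if i: "\<not> exceptional i" and p: "p \<in> block R i" and q: "q \<in> block R i" for i p q
  proof -
    have "mat_comm (block R i) M N p q = 0"
    proof (rule mat_comm_scalar[OF fin_block p q, where \<nu> = "N i i"])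
      fix p q assume pq: "p \<in> block R i" "q \<in> block R i"
      then have "\<not> exceptional p" "q \<in> block R p" "p \<in> block R i"
        using i exceptional_block block_eq by auto
      then show "N p q = (if p = q then N i i else 0)" using N pq i by (auto simp: rad_def)
    qed
    then show ?thesis using comm_block[OF M N' p q] by simp
  qed
  have "mat_comm A M N i i = mat_comm A M N j j \<and> (i \<noteq> j \<longrightarrow> mat_comm A M N i j = 0)"
    if i: "\<not> exceptional i" and j: "j \<in> block R i" for i j
  proof -
    have "i \<in> block R i" using j block_sym block_eq by blast
    then show ?thesis using *[OF i] j by simp
  qed
  then show ?thesis using supp_comm[OF M N'] by (simp add: rad_def)
qed

lemma lideal_rad: "lideal L (c ` rad)"
  unfolding lideal_def lsubspace_def
proof (intro conjI ballI allI)
  show "c ` rad \<subseteq> lcarrier L" using rad_supp carrier_eq by auto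
  show "lzero L \<in> c ` rad" using rad_zero zero_eq by auto
next
  fix x y assume "x \<in> c ` rad" "y \<in> c ` rad"
  then show "ladd L x y \<in> c ` rad" using rad_add by (auto simp: add_eq rad_supp)
next
  fix s x assume "x \<in> c ` rad"
  then show "lscale L s x \<in> c ` rad" using rad_scale by (auto simp: scale_eq rad_supp)
next
  fix x y assume "x \<in> lcarrier L" "y \<in> c ` rad"
  then show "lbr L x y \<in> c ` rad" using rad_ideal carrier_eq by (auto simp: br_eq rad_supp)
qed

text \<open>Bounds one step of the derived series by commutators of representatives, without
  injectivity of \<open>c\<close>: it is enough that \<open>D\<close> is closed under the
  combinations that \<open>lspan\<close> produces.\<close>

lemma lderived_step:
  assumes "lderived L I n \<subseteq> c ` F" "F \<subseteq> supported R" "D \<subseteq> supported R"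
    and "(\<lambda>_ _. 0) \<in> D" "\<And>M N s. M \<in> D \<Longrightarrow> N \<in> D \<Longrightarrow> (\<lambda>i j. s * M i j + N i j) \<in> D"
    and "\<And>M N. M \<in> F \<Longrightarrow> N \<in> F \<Longrightarrow> mat_comm A M N \<in> D"
  shows "lderived L I (Suc n) \<subseteq> c ` D"
proof
  fix x assume "x \<in> lderived L I (Suc n)"
  then have "x \<in> lspan L {lbr L x y |x y. x \<in> lderived L I n \<and> y \<in> lderived L I n}" by simp
  then show "x \<in> c ` D"
  proof induction
    case zero then show ?case using assms(4) zero_eq by auto
  next
    case (step x y s)
    then obtain x1 x2 N where "x = lbr L x1 x2" "x1 \<in> lderived L I n" "x2 \<in> lderived L I n" "N \<in> D" "y = c N"
      by blast
    moreover from this obtain M1 M2 where M: "M1 \<in> F" "M2 \<in> F" "x1 = c M1" "x2 = c M2"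
      using assms(1) by blast
    ultimately have "x = c (mat_comm A M1 M2)" "mat_comm A M1 M2 \<in> D" "N \<in> D" "y = c N"
      using assms(2,6) br_eq by blast+
    moreover from this have "ladd L (lscale L s x) y = c (\<lambda>i j. s * mat_comm A M1 M2 i j + N i j)"
      using assms(3) by (auto simp: scale_eq add_eq supp_scale subset_iff)
    ultimately show ?case using assms(5) by blast
  qed
qed

text \<open>A height function for the preorder. It grows strictly along strict relations and so
  turns nilpotency of the part above the blocks into arithmetic.\<close>

definition down_card :: "'a \<Rightarrow> nat" where "down_card i = card {k. R k i}"

definition strict_layer :: "nat \<Rightarrow> ('a, 'k) mat set" where
  "strict_layer m = {M \<in> supported R. \<forall>i j. M i j \<noteq> 0 \<longrightarrow> down_card i + m \<le> down_card j}"

lemma fin_down: "finite {k. R k i}"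
  by (rule finite_subset[OF _ finA]) (use R_in in auto)

lemma down_card_less: "R i j \<Longrightarrow> \<not> R j i \<Longrightarrow> down_card i < down_card j"
  unfolding down_card_def
proof (rule psubset_card_mono[OF fin_down])
  assume "R i j" "\<not> R j i"
  then show "{k. R k i} \<subset> {k. R k j}" using R_trans R_refl R_in by blast
qed

text \<open>A nonzero term of either product passes through an intermediate index and raises the
  height by at least \<open>m\<close> twice, hence by more than \<open>m\<close>.\<close>

lemma strict_layer_comm:
  assumes "M \<in> strict_layer m" "N \<in> strict_layer m" "0 < m"
  shows "mat_comm A M N \<in> strict_layer (Suc m)"
proof -
  have *: "(\<Sum>k\<in>A. X i k * Y k j) = 0"
    if "X \<in> strict_layer m" "Y \<in> strict_layer m" "\<not> down_card i + Suc m \<le> down_card j" for X Y i j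
  proof (rule sum.neutral, rule ballI)
    fix k
    show "X i k * Y k j = 0"
    proof (rule ccontr)
      assume "X i k * Y k j \<noteq> 0"
      then have "down_card i + m \<le> down_card k" "down_card k + m \<le> down_card j"
        using that by (auto simp: strict_layer_def)
      then show False using that(3) assms(3) by simp
    qed
  qed
  have "mat_comm A M N i j = 0" if "\<not> down_card i + Suc m \<le> down_card j" for i j
    using *[OF assms(1,2) that] *[OF assms(2,1) that] by (simp add: mat_comm_def)
  then show ?thesis using supp_comm assms(1,2) unfolding strict_layer_def by blast
qed

lemma lsolvable_rad: "lsolvable L (c ` rad)"
proof -
  \<comment> \<open>\<open>F1\<close> makes the diagonal constant on every block, \<open>F2\<close>
    makes every block scalar. On an exceptional pair these are sl_2 and the scalars, the successive
    derived algebras of gl_2 in characteristic 2.\<close>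
  define F1 where "F1 = {M \<in> rad. \<forall>i. \<forall>j \<in> block R i. M i i = M j j}"
  define F2 where "F2 = {M \<in> F1. \<forall>i. \<forall>j \<in> block R i. i \<noteq> j \<longrightarrow> M i j = 0}"
  have pair: "block R i = {i, j} \<and> (2::'k) = 0" if "exceptional i" "j \<in> block R i" "i \<noteq> j" for i j
  proof -
    have "card (block R i) = 2" using that by (simp add: exceptional_def)
    moreover have "{i, j} \<subseteq> block R i" using that block_sym block_eq by blast
    ultimately have "block R i = {i, j}"
      using card_subset_eq[OF fin_block, of "{i, j}" i] that(3) by simp
    moreover have "of_nat 2 = (0::'k)"
      using of_nat_CHAR[where 'a = 'k] that(1) by (simp only: exceptional_def)
    ultimately show ?thesis by simp
  qed
  have sm: "(\<lambda>i j. s * M i j + N i j) \<in> rad" if "M \<in> rad" "N \<in> rad" for M N s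
    using rad_add[OF rad_scale] that by blast
  have D1: "lderived L (c ` rad) (Suc 0) \<subseteq> c ` F1"
  proof (rule lderived_step[where F = rad])
    fix M N assume MN: "M \<in> rad" "N \<in> rad"
    have r: "mat_comm A M N \<in> rad" using rad_ideal MN rad_supp by blast
    have "mat_comm A M N i i = mat_comm A M N j j" if j: "j \<in> block R i" "i \<noteq> j" for i j
    proof (cases "exceptional i")
      case False then show ?thesis using r j by (simp add: rad_def)
    next
      case True
      note p = pair[OF True j]
      have m: "i \<in> block R i" "j \<in> block R i" using p by auto
      \<comment> \<open>The two diagonal entries of a 2 by 2 commutator are negatives of each other,
        hence equal in characteristic 2.\<close>
      have d: "x - y = y - x" for x y :: 'k
      proof -
        have "x - y - (y - x) = 2 * (x - y)" by simp
        then show ?thesis using p by simp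
      qed
      show ?thesis
        unfolding comm_block[OF rad_supp[OF MN(1)] rad_supp[OF MN(2)] m(1) m(1)]
          comm_block[OF rad_supp[OF MN(1)] rad_supp[OF MN(2)] m(2) m(2)]
        using conjunct1[OF p] j(2) d[of "M i j * N j i" "N i j * M j i"]
        by (simp add: mat_comm_def algebra_simps)
    qed
    then show "mat_comm A M N \<in> F1" using r unfolding F1_def by fastforce
  qed (use sm rad_supp rad_zero in \<open>auto simp: F1_def\<close>)
  have D2: "lderived L (c ` rad) (Suc (Suc 0)) \<subseteq> c ` F2"
  proof (rule lderived_step[OF D1])
    fix M N assume MN: "M \<in> F1" "N \<in> F1"
    then have MN': "M \<in> rad" "N \<in> rad" by (auto simp: F1_def)
    have r: "mat_comm A M N \<in> rad" using rad_ideal MN' rad_supp by blast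
    have e: "mat_comm A M N i i = mat_comm A M N j j \<and> mat_comm A M N i j = 0"
      if j: "j \<in> block R i" "i \<noteq> j" for i j
    proof (cases "exceptional i")
      case False then show ?thesis using r j by (simp add: rad_def)
    next
      case True
      note p = pair[OF True j]
      have m: "i \<in> block R i" "j \<in> block R i" using p by auto
      have d: "x - y = y - x" for x y :: 'k
      proof -
        have "x - y - (y - x) = 2 * (x - y)" by simp
        then show ?thesis using p by simp
      qed
      have "M i i = M j j" "N i i = N j j" using MN j by (auto simp: F1_def)
      then show ?thesis
        unfolding comm_block[OF rad_supp[OF MN'(1)] rad_supp[OF MN'(2)] m(1) m(1)]
          comm_block[OF rad_supp[OF MN'(1)] rad_supp[OF MN'(2)] m(2) m(2)]
          comm_block[OF rad_supp[OF MN'(1)] rad_supp[OF MN'(2)] m(1) m(2)]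
        using conjunct1[OF p] j(2) d[of "M i j * N j i" "N i j * M j i"]
        by (simp add: mat_comm_def algebra_simps)
    qed
    then show "mat_comm A M N \<in> F2" using r unfolding F1_def F2_def by fastforce
  qed (use sm rad_supp rad_zero in \<open>auto simp: F1_def F2_def\<close>)
  have F2: "F2 \<subseteq> supported R" using rad_supp by (auto simp: F1_def F2_def)
  have layer: "strict_layer m \<subseteq> supported R" for m by (auto simp: strict_layer_def)
  have lz: "(\<lambda>_ _. 0) \<in> strict_layer m" for m using supp_zero by (simp add: strict_layer_def)
  have ls: "(\<lambda>i j. s * M i j + N i j) \<in> strict_layer m"
    if "M \<in> strict_layer m" "N \<in> strict_layer m" for M N s m
  proof -
    have "M i j \<noteq> 0 \<or> N i j \<noteq> 0" if "s * M i j + N i j \<noteq> 0" for i j using that by auto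
    then show ?thesis
      using that supp_add[OF supp_scale[of M s], of N] unfolding strict_layer_def by blast
  qed
  \<comment> \<open>Scalar blocks cancel in a commutator, so from here on only entries strictly
    above the blocks remain, and each further step gains at least one unit of height.\<close>
  have D3: "lderived L (c ` rad) (Suc (Suc (Suc 0))) \<subseteq> c ` strict_layer 1"
  proof (rule lderived_step[OF D2])
    fix M N assume MN: "M \<in> F2" "N \<in> F2"
    have s: "M \<in> supported R" "N \<in> supported R" using MN rad_supp by (auto simp: F1_def F2_def)
    have "down_card i + 1 \<le> down_card j" if nz: "mat_comm A M N i j \<noteq> 0" for i j
    proof -
      have R: "R i j" using nz suppD[OF supp_comm[OF s]] by blast
      have "\<not> R j i"
      proof
        assume "R j i"
        then have j: "j \<in> block R i" using R by (simp add: block_def)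
        then have i: "i \<in> block R i" using block_sym block_eq by blast
        have "mat_comm (block R i) M N i j = 0"
        proof (rule mat_comm_scalar[OF fin_block i j, where \<nu> = "N i i"])
          fix p q assume p: "p \<in> block R i" and "q \<in> block R i"
          then have "q \<in> block R p" using block_eq by blast
          then have "p \<noteq> q \<longrightarrow> N p q = 0" "N p p = N i i"
            using MN(2) p unfolding F1_def F2_def by simp_all
          then show "N p q = (if p = q then N i i else 0)" by auto
        qed
        then show False using comm_block[OF s i j] nz by simp
      qed
      then show ?thesis using down_card_less R by fastforce
    qed
    then show "mat_comm A M N \<in> strict_layer 1" using supp_comm[OF s] by (simp add: strict_layer_def)
  qed (use F2 layer lz ls in blast)+
  have D: "lderived L (c ` rad) (Suc (Suc (Suc m))) \<subseteq> c ` strict_layer (Suc m)" for m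
  proof (induction m)
    case 0 then show ?case using D3 by simp
  next
    case (Suc m)
    show ?case
      by (rule lderived_step[OF Suc]) (use layer lz ls strict_layer_comm[OF _ _ zero_less_Suc] in blast)+
  qed
  have "down_card j \<le> card A" for j
    unfolding down_card_def by (rule card_mono[OF finA]) (use R_in in auto)
  then have no: "\<not> down_card i + Suc (card A) \<le> down_card j" for i j
    by (metis Suc_n_not_le_n add_leD2 le_trans)
  have "strict_layer (Suc (card A)) \<subseteq> {\<lambda>_ _. 0}"
    unfolding strict_layer_def using no by (auto intro!: ext)
  then have "lderived L (c ` rad) (Suc (Suc (Suc (card A)))) \<subseteq> {lzero L}"
    using D[of "card A"] zero_eq by auto
  moreover have "lzero L \<in> lderived L (c ` rad) (Suc (Suc (Suc (card A))))"
    by (simp add: lspan.zero)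
  ultimately show ?thesis unfolding lsolvable_def by blast
qed

end

section \<open>Maximality: a non-scalar ordinary block survives the derived series\<close>

lemma two_neq_zero_if_CHAR:
  assumes "CHAR('k::field) \<noteq> 2" shows "(2::'k) \<noteq> 0"
proof
  assume "(2::'k) = 0"
  then have "of_nat 2 = (0::'k)" by simp
  then have "CHAR('k) dvd 2" by (simp only: of_nat_eq_0_iff_char_dvd)
  then have "CHAR('k) = 1 \<or> CHAR('k) = 2"
    by (metis prime_nat_iff two_is_prime_nat)
  then show False using assms by simp
qed

context incidence_quotient
begin

text \<open>Projection of \<open>I\<close> to one block, read on representatives. Only entries
  inside the block are compared, so \<open>X\<close> is arbitrary elsewhere.\<close>

definition block_image :: "'a \<Rightarrow> 'x set \<Rightarrow> ('a, 'k) mat set" where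
  "block_image a I = {X. \<exists>M \<in> supported R. c M \<in> I \<and> (\<forall>p\<in>block R a. \<forall>q\<in>block R a. M p q = X p q)}"

lemma block_image_cong:
  assumes "X \<in> block_image a I" "\<And>p q. p \<in> block R a \<Longrightarrow> q \<in> block R a \<Longrightarrow> X p q = Y p q"
  shows "Y \<in> block_image a I"
  using assms unfolding block_image_def by fastforce

text \<open>The scalar \<open>s\<close> absorbs the signs and factors 2 that arise when a commutator
  is normalised to a matrix unit; the derived series consists of spans, so scaling is
  allowed.\<close>

lemma block_image_derived:
  assumes "X \<in> block_image a (lderived L J n)" "Y \<in> block_image a (lderived L J n)"
    and "\<And>p q. p \<in> block R a \<Longrightarrow> q \<in> block R a \<Longrightarrow> s * mat_comm (block R a) X Y p q = T p q"
  shows "T \<in> block_image a (lderived L J (Suc n))"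
proof -
  obtain M N where M: "M \<in> supported R" "c M \<in> lderived L J n"
      "\<And>p q. p \<in> block R a \<Longrightarrow> q \<in> block R a \<Longrightarrow> M p q = X p q"
    and N: "N \<in> supported R" "c N \<in> lderived L J n"
      "\<And>p q. p \<in> block R a \<Longrightarrow> q \<in> block R a \<Longrightarrow> N p q = Y p q"
    using assms(1,2) unfolding block_image_def by auto
  \<comment> \<open>The \<open>+ 0\<close> mirrors \<open>lspan.step\<close>, which adds the scaled
    bracket to an element already in the span, here \<open>lzero\<close>.\<close>
  let ?C = "\<lambda>i j. s * mat_comm A M N i j + 0"
  have "ladd L (lscale L s (lbr L (c M) (c N))) (lzero L) \<in> lderived L J (Suc n)"
    unfolding lderived.simps by (rule lspan.step[OF _ lspan.zero]) (use M N in blast)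
  moreover have "ladd L (lscale L s (lbr L (c M) (c N))) (lzero L) = c ?C"
    using M N supp_comm supp_scale supp_zero by (simp add: br_eq scale_eq add_eq zero_eq)
  ultimately have "c ?C \<in> lderived L J (Suc n)" by simp
  moreover have "?C \<in> supported R" using supp_scale[OF supp_comm[OF M(1) N(1)]] by simp
  moreover have "?C p q = T p q" if "p \<in> block R a" "q \<in> block R a" for p q
    using comm_block[OF M(1) N(1) that] mat_comm_cong[OF M(3) N(3) that] assms(3)[OF that] by simp
  ultimately show ?thesis unfolding block_image_def by blast
qed

text \<open>All matrix units of the block are supported, so the image of an ideal is stable under
  brackets with the whole matrix algebra of the block.\<close>

lemma block_image_ideal:
  assumes J: "lideal L J" and X: "X \<in> block_image a J"
  shows "(\<lambda>p q. s * X p q) \<in> block_image a J"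
    and "Y \<in> block_image a J \<Longrightarrow> (\<lambda>p q. X p q + Y p q) \<in> block_image a J"
    and "u \<in> block R a \<Longrightarrow> v \<in> block R a \<Longrightarrow> mat_comm (block R a) (unit_mat u v) X \<in> block_image a J"
proof -
  obtain M where M: "M \<in> supported R" "c M \<in> J"
      "\<And>p q. p \<in> block R a \<Longrightarrow> q \<in> block R a \<Longrightarrow> M p q = X p q"
    using X unfolding block_image_def by auto
  have "c (\<lambda>p q. s * M p q) \<in> J"
    using M J scale_eq[OF M(1)] unfolding lideal_def lsubspace_def by metis
  then show "(\<lambda>p q. s * X p q) \<in> block_image a J"
    unfolding block_image_def using supp_scale[OF M(1)] M(3) by fastforce
  show "(\<lambda>p q. X p q + Y p q) \<in> block_image a J" if Y: "Y \<in> block_image a J"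
  proof -
    obtain N where N: "N \<in> supported R" "c N \<in> J"
        "\<And>p q. p \<in> block R a \<Longrightarrow> q \<in> block R a \<Longrightarrow> N p q = Y p q"
      using Y unfolding block_image_def by auto
    have "c (\<lambda>p q. M p q + N p q) \<in> J"
      using M N J add_eq[OF M(1) N(1)] unfolding lideal_def lsubspace_def by metis
    then show ?thesis
      unfolding block_image_def using supp_add[OF M(1) N(1)] M(3) N(3) by fastforce
  qed
  show "mat_comm (block R a) (unit_mat u v) X \<in> block_image a J"
    if uv: "u \<in> block R a" "v \<in> block R a"
  proof -
    have "R u v" using uv R_trans unfolding block_def by blast
    then have U: "(unit_mat u v :: ('a, 'k) mat) \<in> supported R" by (rule supp_unit)
    have "c (mat_comm A (unit_mat u v) M) \<in> J"
      using M J br_eq[OF U M(1)] U unfolding lideal_def carrier_eq by (metis imageI)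
    moreover have "mat_comm A (unit_mat u v) M p q = mat_comm (block R a) (unit_mat u v) X p q"
      if "p \<in> block R a" "q \<in> block R a" for p q
      using comm_block[OF U M(1) that] mat_comm_cong[OF refl M(3) that] by simp
    ultimately show ?thesis
      unfolding block_image_def using supp_comm[OF U M(1)] by blast
  qed
qed

lemmas comm_unit = mat_comm_unit_left[OF fin_block]

lemma unit_comm_scaled:
  assumes J: "lideal L J" and X: "X \<in> block_image a J" and "u \<in> block R a" "v \<in> block R a"
    and "\<And>p q. p \<in> block R a \<Longrightarrow> q \<in> block R a \<Longrightarrow>
      s * ((if p = u then X v q else 0) - (if q = v then X p u else 0)) = T p q"
  shows "T \<in> block_image a J"
  by (rule block_image_cong[OF block_image_ideal(1)[OF J block_image_ideal(3)[OF J X assms(3,4)], of s]])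
    (use assms in \<open>simp add: comm_unit\<close>)

text \<open>In a block that is not a pair in characteristic 2, one non-scalar matrix generates
  all off-diagonal matrix units; a diagonal difference is moved off the diagonal by
  \<open>[E\<^sub>i\<^sub>j, M]\<close>.\<close>

lemma block_image_units:
  assumes J: "lideal L J" and X: "X \<in> block_image a J" and "\<not> exceptional a"
    and i: "i \<in> block R a" and j: "j \<in> block R a" and ij: "i \<noteq> j"
    and ne: "X i j \<noteq> 0 \<or> X i i \<noteq> X j j"
    and u: "u \<in> block R a" and v: "v \<in> block R a" and uv: "u \<noteq> v"
  shows "unit_mat u v \<in> block_image a J"
proof -
  let ?S = "block R a" and ?P = "block_image a J"
  \<comment> \<open>This alternative is what being non-exceptional buys: 2 is invertible, or any two
    indices of the block leave a third.\<close>
  have third: "(2::'k) \<noteq> 0 \<or> (\<exists>k\<in>?S. k \<noteq> p \<and> k \<noteq> q)" if "p \<in> ?S" "q \<in> ?S" "p \<noteq> q" for p q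
  proof (cases "CHAR('k) = 2")
    case True
    then have "card ?S \<noteq> 2" using assms(3) by (simp add: exceptional_def)
    then have "?S \<noteq> {p, q}" using that(3) by auto
    then show ?thesis using that by blast
  next
    case False
    then show ?thesis using two_neq_zero_if_CHAR by blast
  qed
  have off: "\<exists>Y \<in> ?P. Y i j \<noteq> 0"
  proof (cases "X i j = 0")
    case True
    then have "X i i \<noteq> X j j" using ne by simp
    then have "mat_comm ?S (unit_mat i j) X i j \<noteq> 0" unfolding comm_unit[OF i j] by simp
    then show ?thesis using block_image_ideal(3)[OF J X i j] by blast
  qed (use X in blast)
  then obtain Y where Y: "Y \<in> ?P" "Y i j \<noteq> 0" by blast
  \<comment> \<open>\<open>N\<close> is [[E_ii, Y], E_jj]; all entries of \<open>Y\<close> except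
    those at (i, j) and (j, i) are removed.\<close>
  define N where "N = (\<lambda>p q. Y i j * unit_mat i j p q + Y j i * unit_mat j i p q)"
  have N: "N \<in> ?P"
  proof (rule unit_comm_scaled[OF J block_image_ideal(3)[OF J Y(1) i i] j j, where s = "-1"])
    fix p q assume "p \<in> ?S" "q \<in> ?S"
    then show "-1 * ((if p = j then mat_comm ?S (unit_mat i i) Y j q else 0) -
          (if q = j then mat_comm ?S (unit_mat i i) Y p j else 0)) = N p q"
      unfolding comm_unit[OF i i] using ij by (auto simp: N_def unit_mat_def)
  qed
  have "\<exists>b b'. b \<in> ?S \<and> b' \<in> ?S \<and> b \<noteq> b' \<and> unit_mat b b' \<in> ?P"
    using third[OF i j ij]
  proof
    assume "\<exists>k\<in>?S. k \<noteq> i \<and> k \<noteq> j"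
    then obtain k where k: "k \<in> ?S" "k \<noteq> i" "k \<noteq> j" by blast
    \<comment> \<open>[E_jk, N] is E_ik with coefficient \<open>- Y i j\<close>: the third index
      separates the two positions.\<close>
    have "unit_mat i k \<in> ?P"
      by (rule unit_comm_scaled[OF J N j k(1), where s = "- inverse (Y i j)"])
        (use Y(2) k ij in \<open>auto simp: N_def unit_mat_def\<close>)
    then show ?thesis using i k by blast
  next
    assume 2: "(2::'k) \<noteq> 0"
    \<comment> \<open>ad E_ii has eigenvalues 1 and -1 on E_ij and E_ji, so adding [E_ii, N] to
      \<open>N\<close> doubles the first part and cancels the second.\<close>
    have e: "N p q + mat_comm ?S (unit_mat i i) N p q = (2 * Y i j) * unit_mat i j p q" for p q
      unfolding comm_unit[OF i i] using ij by (simp add: N_def unit_mat_def)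
    have "unit_mat i j \<in> ?P"
    proof (rule block_image_cong[OF block_image_ideal(1)[OF J
            block_image_ideal(2)[OF J N block_image_ideal(3)[OF J N i i]], where s = "inverse (2 * Y i j)"]])
      show "inverse (2 * Y i j) * (N p q + mat_comm ?S (unit_mat i i) N p q) = unit_mat i j p q" for p q
        unfolding e using Y(2) 2 by (simp flip: mult.assoc)
    qed
    then show ?thesis using i j ij by blast
  qed
  then obtain b b' where b: "b \<in> ?S" "b' \<in> ?S" "b \<noteq> b'" "unit_mat b b' \<in> ?P" by blast
  \<comment> \<open>\<open>row\<close> and \<open>col\<close> change one index of a unit by one
    bracket. The side conditions keep the result off the diagonal, where the bracket would acquire a
    second term.\<close>
  have row: "unit_mat p q' \<in> ?P"
    if "unit_mat p' q' \<in> ?P" "p \<in> ?S" "p' \<in> ?S" "q' \<in> ?S" "p \<noteq> q'" for p p' q'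
    by (cases "p = p'", use that in simp)
      (rule unit_comm_scaled[OF J that(1) that(2,3), where s = 1], use that in \<open>auto simp: unit_mat_def\<close>)
  have col: "unit_mat p' q \<in> ?P"
    if "unit_mat p' q' \<in> ?P" "q \<in> ?S" "p' \<in> ?S" "q' \<in> ?S" "p' \<noteq> q" for q p' q'
    by (cases "q = q'", use that in simp)
      (rule unit_comm_scaled[OF J that(1) that(4,2), where s = "-1"], use that in \<open>auto simp: unit_mat_def\<close>)
  \<comment> \<open>With two indices such moves never transpose a unit. This takes a detour through
    a third index or the identity [E_b'b, [E_b'b, E_bb']] = -2 E_b'b.\<close>
  have rev: "unit_mat b' b \<in> ?P"
    using third[OF b(1-3)]
  proof
    assume "\<exists>k\<in>?S. k \<noteq> b \<and> k \<noteq> b'"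
    then obtain k where k: "k \<in> ?S" "k \<noteq> b" "k \<noteq> b'" by blast
    have "unit_mat k b' \<in> ?P" using row[OF b(4) k(1) b(1,2)] k by blast
    then have "unit_mat k b \<in> ?P" using col[OF _ b(1) k(1) b(2)] k by blast
    then show ?thesis using row[OF _ b(2) k(1) b(1)] b by metis
  next
    assume 2: "(2::'k) \<noteq> 0"
    let ?H = "mat_comm ?S (unit_mat b' b) (unit_mat b b')"
    have e: "(if p = b' then ?H b q else 0) - (if q = b then ?H p b' else 0) = (-2) * unit_mat b' b p q" for p q
      unfolding comm_unit[OF b(2,1)] using b(3) by (simp add: unit_mat_def)
    show ?thesis
      by (rule unit_comm_scaled[OF J block_image_ideal(3)[OF J b(4) b(2,1)] b(2,1), where s = "- inverse 2"])
        (unfold e, use 2 in \<open>simp flip: mult.assoc\<close>)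
  qed
  show ?thesis
  proof (cases "u = b'")
    case False
    then have "unit_mat u b' \<in> ?P" using row[OF b(4) u b(1,2)] by blast
    then show ?thesis using col[OF _ v u b(2) uv] by blast
  next
    case True
    then show ?thesis using col[OF rev v b(2,1)] uv by blast
  qed
qed

text \<open>Terms of the derived series may be bracketed only with each other, so the invariant must
  reproduce itself. It includes the differences E_uu - E_vv because on a two-element block E_uv is
  recovered from its bracket with them.\<close>

lemma block_image_lderived:
  assumes J: "lideal L J" and X: "X \<in> block_image a J" and ex: "\<not> exceptional a"
    and i: "i \<in> block R a" and j: "j \<in> block R a" and ij: "i \<noteq> j"
    and ne: "X i j \<noteq> 0 \<or> X i i \<noteq> X j j"
  shows "\<forall>u\<in>block R a. \<forall>v\<in>block R a. u \<noteq> v \<longrightarrow>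
    unit_mat u v \<in> block_image a (lderived L J n) \<and>
    (\<lambda>p q. unit_mat u u p q - unit_mat v v p q) \<in> block_image a (lderived L J n)"
proof (induction n)
  case 0
  note U = block_image_units[OF assms]
  have "(\<lambda>p q. unit_mat u u p q - unit_mat v v p q) \<in> block_image a J"
    if "u \<in> block R a" "v \<in> block R a" "u \<noteq> v" for u v
    by (rule unit_comm_scaled[OF J U[OF that(2,1)] that(1,2), where s = 1])
      (use that in \<open>auto simp: unit_mat_def\<close>)
  then show ?case using U by simp
next
  case (Suc n)
  let ?P = "block_image a (lderived L J n)" and ?Q = "block_image a (lderived L J (Suc n))"
  show ?case
  proof (intro ballI impI conjI)
    fix u v assume uv: "u \<in> block R a" "v \<in> block R a" "u \<noteq> v"
    have E: "unit_mat u v \<in> ?P" "unit_mat v u \<in> ?P"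
      "(\<lambda>p q. unit_mat u u p q - unit_mat v v p q) \<in> ?P" using Suc uv by auto
    show "(\<lambda>p q. unit_mat u u p q - unit_mat v v p q) \<in> ?Q"
      by (rule block_image_derived[OF E(1,2), where s = 1])
        (unfold comm_unit[OF uv(1,2)], use uv in \<open>auto simp: unit_mat_def\<close>)
    show "unit_mat u v \<in> ?Q"
    proof (cases "\<exists>k\<in>block R a. k \<noteq> u \<and> k \<noteq> v")
      case True
      then obtain k where k: "k \<in> block R a" "k \<noteq> u" "k \<noteq> v" by blast
      then have "unit_mat u k \<in> ?P" "unit_mat k v \<in> ?P" using Suc uv by auto
      then show ?thesis
        by (rule block_image_derived[where s = 1])
          (unfold comm_unit[OF uv(1) k(1)], use uv k in \<open>auto simp: unit_mat_def\<close>)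
    next
      case False
      then have S: "block R a = {u, v}" using uv by blast
      then have "card (block R a) = 2" using uv by simp
      then have ch: "CHAR('k) \<noteq> 2" using ex by (simp add: exceptional_def)
      note 2 = two_neq_zero_if_CHAR[OF ch]
      have e: "mat_comm (block R a) (unit_mat u v) (\<lambda>p q. unit_mat u u p q - unit_mat v v p q) p q
          = (-2) * unit_mat u v p q" for p q
        unfolding comm_unit[OF uv(1,2)] using uv by (simp add: unit_mat_def)
      show ?thesis
        by (rule block_image_derived[OF E(1,3), where s = "- inverse 2"])
          (unfold e, use 2 in \<open>simp flip: mult.assoc\<close>)
    qed
  qed
qed

theorem radical: "lradical L (lspan L (c ` gens))"
  unfolding lradical_def lspan_gens
proof (intro conjI allI impI subsetI lideal_rad lsolvable_rad)
  fix J x assume "lideal L J \<and> lsolvable L J" and x: "x \<in> J"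
  then have J: "lideal L J" and "lsolvable L J" by auto
  then obtain n where n: "lderived L J n = {lzero L}" by (auto simp: lsolvable_def)
  have "x \<in> lcarrier L" using J x unfolding lideal_def lsubspace_def by blast
  then obtain M where M: "M \<in> supported R" "x = c M" using carrier_eq by auto
  show "x \<in> c ` rad"
  proof (rule ccontr)
    assume "x \<notin> c ` rad"
    then have "M \<notin> rad" using M(2) by blast
    then obtain i j where ij: "\<not> exceptional i" "j \<in> block R i" "i \<noteq> j"
      "M i j \<noteq> 0 \<or> M i i \<noteq> M j j"
      using M(1) unfolding rad_def by blast
    have "M \<in> block_image i J" using M x unfolding block_image_def by blast
    moreover have i: "i \<in> block R i" using ij(2) block_sym block_eq by blast
    ultimately have "unit_mat i j \<in> block_image i (lderived L J n)"
      using block_image_lderived[OF J _ ij(1) _ ij(2-4)] ij by blast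
    \<comment> \<open>The vanishing derived term would contain the class of a matrix with an
      off-diagonal entry 1, yet a zero class has only diagonal representatives.\<close>
    then obtain N where "N \<in> supported R" "c N = lzero L" "N i j = 1"
      unfolding n block_image_def using i ij(2) by (auto simp: unit_mat_def)
    then show False using kernel ij(3) by force
  qed
qed

end

section \<open>Paths\<close>

locale monomial_quiver =
  fixes Q :: "('v, 'a) quiver" and Z :: "('v, 'a) qpath set"
  assumes fq: "finite_quiver Q" and mr: "minimal_relations Q Z" and finB: "finite (Bpaths Q Z)"
begin

abbreviation "B \<equiv> Bpaths Q Z"

lemma pterm_append: "pterm Q (pterm Q (v, xs), ys) = pterm Q (v, xs @ ys)"
  by (simp add: pterm_def)

lemma pterm_Nil [simp]: "pterm Q (v, []) = v"
  by (simp add: pterm_def)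

lemma pterm_snoc [simp]: "pterm Q (v, xs @ [a]) = tgt Q a"
  by (simp add: pterm_def)

lemma pterm_Cons: "pterm Q (v, a # xs) = pterm Q (tgt Q a, xs)"
  by (simp add: pterm_def)

lemma is_path_Nil [simp]: "is_path Q (v, []) \<longleftrightarrow> v \<in> verts Q"
  by (simp add: is_path_def)

lemma is_path_Cons:
  "is_path Q (v, a # xs) \<longleftrightarrow> a \<in> arrs Q \<and> src Q a = v \<and> is_path Q (tgt Q a, xs)"
proof -
  have "(\<forall>i. Suc i < length (a # xs) \<longrightarrow> tgt Q ((a # xs) ! i) = src Q ((a # xs) ! Suc i)) \<longleftrightarrow>
    (xs \<noteq> [] \<longrightarrow> src Q (hd xs) = tgt Q a) \<and>
    (\<forall>i. Suc i < length xs \<longrightarrow> tgt Q (xs ! i) = src Q (xs ! Suc i))" (is "?L \<longleftrightarrow> ?R")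
  proof
    assume L: ?L
    have "xs \<noteq> [] \<longrightarrow> src Q (hd xs) = tgt Q a" using L[rule_format, of 0] by (auto simp: hd_conv_nth)
    moreover have "tgt Q (xs ! i) = src Q (xs ! Suc i)" if "Suc i < length xs" for i
      using L[rule_format, of "Suc i"] that by simp
    ultimately show ?R by blast
  next
    assume R: ?R
    show ?L
    proof (intro allI impI)
      fix i assume "Suc i < length (a # xs)"
      then show "tgt Q ((a # xs) ! i) = src Q ((a # xs) ! Suc i)"
        using R by (cases i) (auto simp: hd_conv_nth)
    qed
  qed
  moreover have "a \<in> arrs Q \<Longrightarrow> src Q a \<in> verts Q \<and> tgt Q a \<in> verts Q"
    using fq by (auto simp: finite_quiver_def)
  ultimately show ?thesis unfolding is_path_def by auto
qed

lemma is_path_append: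
  "is_path Q (v, xs @ ys) \<longleftrightarrow> is_path Q (v, xs) \<and> is_path Q (pterm Q (v, xs), ys)"
proof (induction xs arbitrary: v)
  case Nil
  have "is_path Q (v, ys) \<Longrightarrow> v \<in> verts Q" by (simp add: is_path_def)
  then show ?case by auto
next
  case (Cons a xs)
  then show ?case by (simp add: is_path_Cons pterm_Cons)
qed

lemma B_path: "p \<in> B \<Longrightarrow> is_path Q p"
  by (simp add: Bpaths_def)

lemma B_infix:
  assumes "(v, xs @ ys @ zs) \<in> B" shows "(pterm Q (v, xs), ys) \<in> B"
proof -
  have "is_path Q (pterm Q (v, xs), ys)" using B_path[OF assms] by (simp add: is_path_append)
  moreover have "\<not> subpath Q z (pterm Q (v, xs), ys)" if "z \<in> Z" for z
  proof
    assume "subpath Q z (pterm Q (v, xs), ys)"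
    then obtain us ws where "ys = us @ snd z @ ws" "fst z = pterm Q (pterm Q (v, xs), us)"
      by (auto simp: subpath_def)
    then have "subpath Q z (v, xs @ ys @ zs)"
      unfolding subpath_def by (intro exI[of _ "xs @ us"] exI[of _ "ws @ zs"]) (simp add: pterm_append)
    then show False using assms that by (auto simp: Bpaths_def)
  qed
  ultimately show ?thesis by (auto simp: Bpaths_def)
qed

lemma Z_path: "z \<in> Z \<Longrightarrow> is_path Q z" and Z_length: "z \<in> Z \<Longrightarrow> 2 \<le> length (snd z)"
  using mr by (auto simp: minimal_relations_def)

text \<open>Occurrences of a relation can be read off the arrow list alone: \<open>z\<close> is
  nonempty, so its first arrow fixes its source vertex.\<close>

lemma contains_Z_notin_B:
  assumes "z \<in> Z" shows "(v, xs @ snd z @ ys) \<notin> B"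
proof
  assume v: "(v, xs @ snd z @ ys) \<in> B"
  obtain a zs where z: "snd z = a # zs" using Z_length[OF assms] by (cases "snd z") auto
  have "is_path Q (pterm Q (v, xs), snd z)" using B_path[OF B_infix[OF v]] .
  then have "src Q a = pterm Q (v, xs)" unfolding z by (simp add: is_path_Cons)
  moreover have "src Q a = fst z" using Z_path[OF assms] z is_path_Cons[of "fst z" a zs]
    by (metis prod.collapse)
  ultimately have "subpath Q z (v, xs @ snd z @ ys)"
    unfolding subpath_def by (intro exI[of _ xs] exI[of _ ys]) simp
  then show False using v assms by (auto simp: Bpaths_def)
qed

lemma not_B_obtains:
  assumes "is_path Q (v, xs)" "(v, xs) \<notin> B"
  obtains us z ws where "z \<in> Z" "xs = us @ snd z @ ws"
  using assms by (auto simp: Bpaths_def subpath_def)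

section \<open>Two-sided multiplication by paths\<close>

text \<open>The piece of \<open>q\<close> between the prefix \<open>p\<close> and the suffix
  \<open>r\<close>, computed from lengths only. If \<open>q\<close> does not have this shape the
  value is meaningless, and \<open>factors\<close> rejects it.\<close>

definition middle :: "('v, 'a) qpath \<Rightarrow> ('v, 'a) qpath \<Rightarrow> ('v, 'a) qpath \<Rightarrow> 'a list" where
  "middle p r q = drop (length (snd p)) (take (length (snd q) - length (snd r)) (snd q))"

definition factors :: "('v, 'a) qpath \<Rightarrow> ('v, 'a) qpath \<Rightarrow> ('v, 'a) qpath \<Rightarrow> bool" where
  "factors p r q \<longleftrightarrow> q \<in> B \<and> fst q = fst p \<and> snd q = snd p @ middle p r q @ snd r \<and>
     pterm Q (pterm Q p, middle p r q) = fst r"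

text \<open>The product \<open>p F r\<close> in the algebra spanned by the paths in \<open>B\<close>, traversing \<open>p\<close> first.\<close>
definition sandwich :: "('v, 'a) qpath \<Rightarrow> (('v, 'a) qpath \<Rightarrow> 'k::field) \<Rightarrow> ('v, 'a) qpath \<Rightarrow>
    ('v, 'a) qpath \<Rightarrow> 'k" where
  "sandwich p F r q = (if factors p r q then F (pterm Q p, middle p r q) else 0)"

lemma middle_append: "middle p r (v, snd p @ ms @ snd r) = ms"
  by (simp add: middle_def)

lemma factors_iff:
  "factors p r q \<longleftrightarrow> (\<exists>ms. q \<in> B \<and> q = (fst p, snd p @ ms @ snd r) \<and> pterm Q (pterm Q p, ms) = fst r)"
proof
  assume "factors p r q"
  then show "\<exists>ms. q \<in> B \<and> q = (fst p, snd p @ ms @ snd r) \<and> pterm Q (pterm Q p, ms) = fst r"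
    unfolding factors_def by (metis prod.collapse)
qed (auto simp: factors_def middle_append)

lemma sandwich_eq:
  "(fst p, snd p @ ms @ snd r) \<in> B \<Longrightarrow> pterm Q (pterm Q p, ms) = fst r \<Longrightarrow>
    sandwich p F r (fst p, snd p @ ms @ snd r) = F (pterm Q p, ms)"
  by (auto simp: sandwich_def factors_def middle_append)

lemma sandwich_nonzeroE:
  assumes "sandwich p F r q \<noteq> 0"
  obtains ms where "q \<in> B" "q = (fst p, snd p @ ms @ snd r)" "pterm Q (pterm Q p, ms) = fst r"
    "F (pterm Q p, ms) \<noteq> 0"
proof -
  have f: "factors p r q" and F: "F (pterm Q p, middle p r q) \<noteq> 0"
    using assms by (auto simp: sandwich_def split: if_splits)
  obtain ms where ms: "q \<in> B" "q = (fst p, snd p @ ms @ snd r)" "pterm Q (pterm Q p, ms) = fst r"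
    using f factors_iff by blast
  then show thesis using that F by (simp add: middle_append)
qed

lemma pterm_pair: "pterm Q (pterm Q p, ys) = pterm Q (fst p, snd p @ ys)"
  by (metis prod.collapse pterm_append)

lemma sandwich_support:
  assumes "sandwich p F r q \<noteq> 0" shows "q \<in> B" "fst q = fst p" "pterm Q q = pterm Q r"
proof -
  obtain ms where ms: "q \<in> B" "q = (fst p, snd p @ ms @ snd r)" "pterm Q (pterm Q p, ms) = fst r"
    using assms by (rule sandwich_nonzeroE)
  show "q \<in> B" "fst q = fst p" using ms by auto
  have "pterm Q q = pterm Q (pterm Q (pterm Q p, ms), snd r)"
    using ms(2) by (simp add: pterm_append pterm_pair)
  then show "pterm Q q = pterm Q r" using ms(3) by simp
qed

lemma sandwich_diff: "sandwich p (\<lambda>q. F q - G q) r q = sandwich p F r q - sandwich p G r q"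
  and sandwich_add: "sandwich p (\<lambda>q. F q + G q) r q = sandwich p F r q + sandwich p G r q"
  and sandwich_scale: "sandwich p (\<lambda>q. s * F q) r q = s * sandwich p F r q"
  and sandwich_minus: "sandwich p (\<lambda>q. - F q) r q = - sandwich p F r q"
  and sandwich_zero: "sandwich p (\<lambda>q. 0) r q = 0"
  by (simp_all add: sandwich_def)

lemma sandwich_sum: "sandwich p (\<lambda>q. \<Sum>i\<in>I. F i q) r q = (\<Sum>i\<in>I. sandwich p (F i) r q)"
  by (simp add: sandwich_def)

text \<open>Associativity, p (p' F r') r = (p p') F (r' r). That no term is lost on the left uses
  that \<open>B\<close> is closed under subpaths.\<close>

lemma sandwich_sandwich:
  assumes "pterm Q p = fst p'" "pterm Q r' = fst r"
  shows "sandwich p (sandwich p' F r') r q =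
    sandwich (fst p, snd p @ snd p') F (fst r', snd r' @ snd r) q"
proof (cases "factors (fst p, snd p @ snd p') (fst r', snd r' @ snd r) q")
  case True
  then obtain ms where ms: "q \<in> B" "q = (fst p, (snd p @ snd p') @ ms @ (snd r' @ snd r))"
    "pterm Q (pterm Q (fst p, snd p @ snd p'), ms) = fst r'"
    unfolding factors_iff by auto
  have t: "pterm Q (fst p, snd p @ snd p') = pterm Q p'"
    using assms(1) by (metis pterm_pair prod.collapse)
  let ?m = "snd p' @ ms @ snd r'"
  have q: "q = (fst p, snd p @ ?m @ snd r)" using ms(2) by simp
  have "pterm Q (pterm Q p, ?m) = pterm Q (pterm Q (pterm Q p', ms), snd r')"
    using assms(1) by (simp add: pterm_append pterm_pair)
  also have "\<dots> = fst r" using ms(3) t assms(2) by simp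
  finally have m: "pterm Q (pterm Q p, ?m) = fst r" .
  have "(pterm Q p, ?m) \<in> B" using B_infix[of "fst p" "snd p" ?m "snd r"] ms(1) q by simp
  then have B': "(fst p', ?m) \<in> B" using assms(1) by simp
  have "sandwich p (sandwich p' F r') r q = sandwich p' F r' (pterm Q p, ?m)"
    using sandwich_eq[of p ?m r] ms(1) q m by simp
  also have "\<dots> = F (pterm Q p', ms)"
    using sandwich_eq[of p' ms r' F] B' ms(3) t assms(1) by simp
  also have "\<dots> = sandwich (fst p, snd p @ snd p') F (fst r', snd r' @ snd r) q"
    using sandwich_eq[of "(fst p, snd p @ snd p')" ms "(fst r', snd r' @ snd r)" F] ms t by simp
  finally show ?thesis .
next
  case False
  have "sandwich p (sandwich p' F r') r q = 0"
  proof (rule ccontr)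
    assume "sandwich p (sandwich p' F r') r q \<noteq> 0"
    then obtain ms where ms: "q \<in> B" "q = (fst p, snd p @ ms @ snd r)"
      "sandwich p' F r' (pterm Q p, ms) \<noteq> 0" by (rule sandwich_nonzeroE)
    obtain ms' where ms': "ms = snd p' @ ms' @ snd r'" "pterm Q (pterm Q p', ms') = fst r'"
      using ms(3) by (elim sandwich_nonzeroE) auto
    have t: "pterm Q (fst p, snd p @ snd p') = pterm Q p'"
      using assms(1) by (metis pterm_pair prod.collapse)
    have "factors (fst p, snd p @ snd p') (fst r', snd r' @ snd r) q"
      unfolding factors_iff using ms ms' t by (intro exI[of _ ms']) auto
    then show False using False by simp
  qed
  then show ?thesis using False by (simp add: sandwich_def)
qed

text \<open>Expansion in the basis \<open>B\<close>, the form in which sums can be interchanged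
  later.\<close>

lemma sandwich_sum_B:
  "sandwich p F r q = (\<Sum>\<gamma>\<in>B. if q \<in> B \<and> fst \<gamma> = pterm Q p \<and> pterm Q \<gamma> = fst r \<and>
      q = (fst p, snd p @ snd \<gamma> @ snd r) then F \<gamma> else 0)"
proof (cases "factors p r q")
  case True
  then obtain ms where ms: "q \<in> B" "q = (fst p, snd p @ ms @ snd r)" "pterm Q (pterm Q p, ms) = fst r"
    using factors_iff by blast
  have B': "(pterm Q p, ms) \<in> B" using B_infix[of "fst p" "snd p" ms "snd r"] ms by simp
  have "(\<Sum>\<gamma>\<in>B. if q \<in> B \<and> fst \<gamma> = pterm Q p \<and> pterm Q \<gamma> = fst r \<and>
      q = (fst p, snd p @ snd \<gamma> @ snd r) then F \<gamma> else 0) =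
      (\<Sum>\<gamma>\<in>B. if \<gamma> = (pterm Q p, ms) then F (pterm Q p, ms) else 0)"
    by (rule sum.cong) (use ms in auto)
  then show ?thesis using B' ms finB by (simp add: sandwich_eq sum.delta)
next
  case False
  have *: "\<not> (q \<in> B \<and> fst \<gamma> = pterm Q p \<and> pterm Q \<gamma> = fst r \<and> q = (fst p, snd p @ snd \<gamma> @ snd r))" for \<gamma>
    using False unfolding factors_iff by (metis prod.collapse)
  show ?thesis unfolding if_not_P[OF *] using False by (simp add: sandwich_def)
qed

end

section \<open>Derivations attached to cochains\<close>

lemma sum_lessThan_add:
  fixes t :: "nat \<Rightarrow> 'b::comm_monoid_add"
  shows "(\<Sum>i<m + n. t i) = (\<Sum>i<m. t i) + (\<Sum>i<n. t (m + i))"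
  by (induction n) (simp_all add: add.assoc)

context monomial_quiver
begin

text \<open>The derivation of the path algebra into the span of \<open>B\<close> which sends an arrow \<open>a\<close> to
  \<open>f (a, _)\<close>.\<close>
definition der :: "('a \<times> ('v, 'a) qpath \<Rightarrow> 'k::field) \<Rightarrow> ('v, 'a) qpath \<Rightarrow> ('v, 'a) qpath \<Rightarrow> 'k" where
  "der f p q = (\<Sum>i<length (snd p). sandwich (fst p, take i (snd p)) (\<lambda>\<gamma>. f (snd p ! i, \<gamma>))
      (pterm Q (fst p, take (Suc i) (snd p)), drop (Suc i) (snd p)) q)"

definition der_ext :: "('a \<times> ('v, 'a) qpath \<Rightarrow> 'k::field) \<Rightarrow> (('v, 'a) qpath \<Rightarrow> 'k) \<Rightarrow> ('v, 'a) qpath \<Rightarrow> 'k" where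
  "der_ext f F q = (\<Sum>\<gamma>\<in>B. F \<gamma> * der f \<gamma> q)"

lemma der_Nil: "der f (v, []) = (\<lambda>_. 0)"
  by (simp add: der_def fun_eq_iff)

lemma der_support:
  assumes "der f p q \<noteq> 0" shows "q \<in> B" "fst q = fst p" "pterm Q q = pterm Q p"
proof -
  obtain i where i: "i < length (snd p)" "sandwich (fst p, take i (snd p)) (\<lambda>\<gamma>. f (snd p ! i, \<gamma>))
      (pterm Q (fst p, take (Suc i) (snd p)), drop (Suc i) (snd p)) q \<noteq> 0"
    using assms unfolding der_def by (metis (no_types, lifting) lessThan_iff sum.neutral)
  show "q \<in> B" "fst q = fst p" using sandwich_support(1,2)[OF i(2)] by auto
  have "pterm Q q = pterm Q (fst p, take (Suc i) (snd p) @ drop (Suc i) (snd p))"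
    using sandwich_support(3)[OF i(2)] by (simp only: pterm_append)
  then show "pterm Q q = pterm Q p" by simp
qed

text \<open>The Leibniz rule D(x y) = D(x) y + x D(y): the sum over positions is cut at
  \<open>length xs\<close>.\<close>

lemma der_append:
  "der f (v, xs @ ys) q = sandwich (v, []) (der f (v, xs)) (pterm Q (v, xs), ys) q
     + sandwich (v, xs) (der f (pterm Q (v, xs), ys)) (pterm Q (v, xs @ ys), []) q"
proof -
  let ?t = "\<lambda>i. sandwich (v, take i (xs @ ys)) (\<lambda>\<gamma>. f ((xs @ ys) ! i, \<gamma>))
      (pterm Q (v, take (Suc i) (xs @ ys)), drop (Suc i) (xs @ ys)) q"
  have "sandwich (v, []) (der f (v, xs)) (pterm Q (v, xs), ys) q = (\<Sum>i<length xs. ?t i)"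
  proof -
    have "sandwich (v, []) (sandwich (v, take i xs) (\<lambda>\<gamma>. f (xs ! i, \<gamma>))
        (pterm Q (v, take (Suc i) xs), drop (Suc i) xs)) (pterm Q (v, xs), ys) q = ?t i"
      if "i < length xs" for i
      using that by (subst sandwich_sandwich) (simp_all add: pterm_append nth_append)
    then show ?thesis
      by (simp add: der_def[abs_def] sandwich_sum)
  qed
  moreover have "sandwich (v, xs) (der f (pterm Q (v, xs), ys)) (pterm Q (v, xs @ ys), []) q
      = (\<Sum>i<length ys. ?t (length xs + i))"
  proof -
    have "sandwich (v, xs) (sandwich (pterm Q (v, xs), take i ys) (\<lambda>\<gamma>. f (ys ! i, \<gamma>))
        (pterm Q (pterm Q (v, xs), take (Suc i) ys), drop (Suc i) ys)) (pterm Q (v, xs @ ys), []) q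
        = ?t (length xs + i)"
      if "i < length ys" for i
      using that by (subst sandwich_sandwich) (simp_all add: pterm_append nth_append Suc_diff_le)
    then show ?thesis
      by (simp add: der_def[abs_def] sandwich_sum)
  qed
  moreover have "der f (v, xs @ ys) q = (\<Sum>i<length xs + length ys. ?t i)" by (simp add: der_def)
  ultimately show ?thesis by (simp only: sum_lessThan_add)
qed

lemma der_append3:
  "der f (v, xs @ ys @ zs) q =
     sandwich (v, []) (der f (v, xs)) (pterm Q (v, xs), ys @ zs) q
   + sandwich (v, xs) (der f (pterm Q (v, xs), ys)) (pterm Q (v, xs @ ys), zs) q
   + sandwich (v, xs @ ys) (der f (pterm Q (v, xs @ ys), zs)) (pterm Q (v, xs @ ys @ zs), []) q"
proof -
  have "der f (pterm Q (v, xs), ys @ zs) =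
    (\<lambda>q. sandwich (pterm Q (v, xs), []) (der f (pterm Q (v, xs), ys)) (pterm Q (v, xs @ ys), zs) q
     + sandwich (pterm Q (v, xs), ys) (der f (pterm Q (v, xs @ ys), zs)) (pterm Q (v, xs @ ys @ zs), []) q)"
    by (rule ext) (simp add: der_append pterm_append)
  then show ?thesis
    unfolding der_append[of f v xs "ys @ zs"]
    by (simp add: sandwich_add sandwich_sandwich pterm_append)
qed

lemma arrow_pterm: "pterm Q (v, [a]) = tgt Q a"
  by (simp add: pterm_def)

lemma C1_support:
  assumes "f \<in> C1 Q Z" "f (a, \<gamma>) \<noteq> 0"
  shows "a \<in> arrs Q" "\<gamma> \<in> B" "fst \<gamma> = src Q a" "pterm Q \<gamma> = tgt Q a"
proof -
  have "(a, \<gamma>) \<in> Q1B Q Z" using assms unfolding C1_def by blast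
  then show "a \<in> arrs Q" "\<gamma> \<in> B" "fst \<gamma> = src Q a" "pterm Q \<gamma> = tgt Q a"
    by (auto simp: Q1B_def parallel_def arrow_path_def arrow_pterm)
qed

lemma der_arrow:
  assumes "f \<in> C1 Q Z" shows "der f (src Q a, [a]) = (\<lambda>\<gamma>. f (a, \<gamma>))"
proof
  fix \<gamma>
  have e: "der f (src Q a, [a]) \<gamma> = sandwich (src Q a, []) (\<lambda>\<gamma>. f (a, \<gamma>)) (tgt Q a, []) \<gamma>"
    by (simp add: der_def arrow_pterm)
  show "der f (src Q a, [a]) \<gamma> = f (a, \<gamma>)"
  proof (cases "f (a, \<gamma>) = 0")
    case True
    have "sandwich (src Q a, []) (\<lambda>\<gamma>. f (a, \<gamma>)) (tgt Q a, []) \<gamma> = 0"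
    proof (rule ccontr)
      assume "sandwich (src Q a, []) (\<lambda>\<gamma>. f (a, \<gamma>)) (tgt Q a, []) \<gamma> \<noteq> 0"
      then obtain ms where "\<gamma> = (src Q a, ms)" "f (a, (src Q a, ms)) \<noteq> 0"
        by (rule sandwich_nonzeroE) simp
      then show False using True by simp
    qed
    then show ?thesis using e True by simp
  next
    case False
    note s = C1_support[OF assms False]
    have \<gamma>: "\<gamma> = (src Q a, snd \<gamma>)" using s(3) by (metis prod.collapse)
    then have "pterm Q (src Q a, snd \<gamma>) = tgt Q a" using s(4) by simp
    then show ?thesis unfolding e
      using sandwich_eq[of "(src Q a, [])" "snd \<gamma>" "(tgt Q a, [])" "\<lambda>\<gamma>. f (a, \<gamma>)"] s \<gamma> by simp
  qed
qed

lemma finite_Q1B: "finite (Q1B Q Z)"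
  by (rule finite_subset[of _ "arrs Q \<times> B"]) (use fq finB in \<open>auto simp: Q1B_def finite_quiver_def\<close>)

lemma path_nth:
  assumes "is_path Q (v, xs)" "i < length xs"
  shows "pterm Q (v, take i xs) = src Q (xs ! i)" "pterm Q (v, take (Suc i) xs) = tgt Q (xs ! i)"
proof -
  have "is_path Q (v, take i xs @ (xs ! i) # drop (Suc i) xs)"
    using assms id_take_nth_drop[OF assms(2)] by simp
  then show "pterm Q (v, take i xs) = src Q (xs ! i)"
    by (simp add: is_path_append is_path_Cons)
  show "pterm Q (v, take (Suc i) xs) = tgt Q (xs ! i)"
    using assms(2) by (simp add: take_Suc_conv_app_nth)
qed

text \<open>Links the occurrence counts in \<open>psi1\<close> and \<open>bracket1\<close> to
  derivations. Both sides sum over the position that is replaced, and at a fixed position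
  \<open>q\<close> determines the replacement as its middle piece.\<close>

lemma der_occ_count:
  assumes f: "f \<in> C1 Q Z" and p: "is_path Q p"
  shows "(\<Sum>u\<in>Q1B Q Z. f u * of_nat (occ_count Q Z p (fst u) (snd u) q)) = der f p q"
proof (cases "q \<in> B")
  case False
  then show ?thesis using der_support(1)[of f p q] by (auto simp: occ_count_def)
next
  case q: True
  obtain v xs where vx: "p = (v, xs)" by fastforce
  let ?n = "length xs"
  have "of_nat (occ_count Q Z p a \<gamma> q) = (\<Sum>i<?n. if xs ! i = a \<and> repl p i \<gamma> = q then 1 else (0::'b))" for a \<gamma>
  proof -
    have "card {i. i < ?n \<and> xs ! i = a \<and> repl p i \<gamma> = q} = (\<Sum>i<?n. if xs ! i = a \<and> repl p i \<gamma> = q then 1 else 0)"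
      by (simp add: sum.If_cases card_eq_sum[symmetric] Int_def conj_commute)
    then show ?thesis using q vx by (simp add: occ_count_def of_nat_sum if_distrib cong: if_cong)
  qed
  then have "(\<Sum>u\<in>Q1B Q Z. f u * of_nat (occ_count Q Z p (fst u) (snd u) q)) =
     (\<Sum>u\<in>Q1B Q Z. \<Sum>i<?n. f u * (if xs ! i = fst u \<and> repl p i (snd u) = q then 1 else 0))"
    by (simp add: sum_distrib_left)
  also have "\<dots> = (\<Sum>i<?n. \<Sum>u\<in>Q1B Q Z. f u * (if xs ! i = fst u \<and> repl p i (snd u) = q then 1 else 0))"
    by (rule sum.swap)
  also have "\<dots> = der f p q"
    unfolding der_def vx fst_conv snd_conv
  proof (rule sum.cong[OF refl])
    fix i assume "i \<in> {..<?n}"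
    then have i: "i < ?n" by simp
    note pt = path_nth[OF p[unfolded vx] i]
    let ?p = "(v, take i xs)" and ?r = "(pterm Q (v, take (Suc i) xs), drop (Suc i) xs)"
    have "(\<Sum>u\<in>Q1B Q Z. f u * (if xs ! i = fst u \<and> repl (v, xs) i (snd u) = q then 1 else 0)) =
      (\<Sum>u\<in>Q1B Q Z. if u = (xs ! i, (src Q (xs ! i), middle ?p ?r q)) then
          (if q = (v, take i xs @ middle ?p ?r q @ drop (Suc i) xs) then f u else 0) else 0)"
    proof (rule sum.cong[OF refl])
      fix u assume u: "u \<in> Q1B Q Z"
      obtain a w ms where ua: "u = (a, (w, ms))" by (metis surj_pair)
      have w: "w = src Q a" using u ua by (auto simp: Q1B_def parallel_def arrow_path_def)
      have "middle ?p ?r (v, take i xs @ ms @ drop (Suc i) xs) = ms"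
        using middle_append[of ?p ?r v ms] by simp
      then have "repl (v, xs) i (w, ms) = q \<longleftrightarrow> ms = middle ?p ?r q \<and> q = (v, take i xs @ ms @ drop (Suc i) xs)"
        by (auto simp: repl_def)
      then show "f u * (if xs ! i = fst u \<and> repl (v, xs) i (snd u) = q then 1 else 0) =
         (if u = (xs ! i, (src Q (xs ! i), middle ?p ?r q)) then
          (if q = (v, take i xs @ middle ?p ?r q @ drop (Suc i) xs) then f u else 0) else 0)"
        unfolding ua using w by (cases "xs ! i = a") auto
    qed
    also have "\<dots> = (if q = (v, take i xs @ middle ?p ?r q @ drop (Suc i) xs)
        then f (xs ! i, (src Q (xs ! i), middle ?p ?r q)) else 0)"
      using f finite_Q1B by (auto simp: sum.delta C1_def)
    also have "\<dots> = sandwich ?p (\<lambda>\<gamma>. f (xs ! i, \<gamma>)) ?r q"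
    proof (cases "q = (v, take i xs @ middle ?p ?r q @ drop (Suc i) xs)
         \<and> f (xs ! i, (src Q (xs ! i), middle ?p ?r q)) \<noteq> 0")
      case True
      then have "pterm Q (src Q (xs ! i), middle ?p ?r q) = tgt Q (xs ! i)"
        using C1_support(4)[OF f] by blast
      then have "sandwich ?p (\<lambda>\<gamma>. f (xs ! i, \<gamma>)) ?r q = f (xs ! i, (src Q (xs ! i), middle ?p ?r q))"
        using sandwich_eq[of ?p "middle ?p ?r q" ?r "\<lambda>\<gamma>. f (xs ! i, \<gamma>)"] True q pt by simp
      then show ?thesis using True by auto
    next
      case False
      then show ?thesis using pt q by (auto simp: sandwich_def factors_def prod_eq_iff)
    qed
    finally show "(\<Sum>u\<in>Q1B Q Z. f u * (if xs ! i = fst u \<and> repl (v, xs) i (snd u) = q then 1 else 0)) =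
      sandwich ?p (\<lambda>\<gamma>. f (xs ! i, \<gamma>)) ?r q" .
  qed
  finally show ?thesis .
qed

lemma KerPsi1_iff: "f \<in> KerPsi1 Q Z \<longleftrightarrow> f \<in> C1 Q Z \<and> (\<forall>p\<in>Z. \<forall>q. der f p q = 0)"
proof -
  have "psi1 Q Z f = (\<lambda>_. 0) \<longleftrightarrow> (\<forall>p\<in>Z. \<forall>q. der f p q = 0)" if f: "f \<in> C1 Q Z"
  proof -
    have "psi1 Q Z f = (\<lambda>(p, q). if p \<in> Z then der f p q else 0)"
      unfolding psi1_def using der_occ_count[OF f Z_path] by (auto simp: fun_eq_iff)
    then show ?thesis by (auto simp: fun_eq_iff)
  qed
  then show ?thesis by (auto simp: KerPsi1_def)
qed

text \<open>Hence \<open>der f\<close> descends to the quotient algebra when \<open>f\<close> is a cocycle.\<close>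
lemma der_notin_B:
  assumes f: "f \<in> KerPsi1 Q Z" and p: "is_path Q (v, xs)" "(v, xs) \<notin> B"
  shows "der f (v, xs) q = 0"
proof -
  obtain us z ws where z: "z \<in> Z" and xs: "xs = us @ snd z @ ws" using not_B_obtains[OF p] .
  have "is_path Q (pterm Q (v, us), snd z)" using p(1) xs by (simp add: is_path_append)
  moreover obtain a zs where a: "snd z = a # zs" using Z_length[OF z] by (cases "snd z") auto
  moreover have "is_path Q (fst z, snd z)" using Z_path[OF z] by simp
  ultimately have "(pterm Q (v, us), snd z) = z" by (auto simp: is_path_Cons prod_eq_iff)
  then have "der f (pterm Q (v, us), snd z) = (\<lambda>_. 0)"
    using f z by (auto simp: KerPsi1_iff)
  \<comment> \<open>The outer two Leibniz terms leave \<open>z\<close> intact and have no component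
    in \<open>B\<close>; the middle one differentiates \<open>z\<close> itself and vanishes by the
    cocycle condition.\<close>
  moreover have "sandwich (v, []) F (w, snd z @ ws) q = 0" for F :: "_ \<Rightarrow> 'b" and w
    using contains_Z_notin_B[OF z] by (auto elim!: sandwich_nonzeroE intro: ccontr)
  moreover have "sandwich (v, us @ snd z) F (w, []) q = 0" for F :: "_ \<Rightarrow> 'b" and w
    using contains_Z_notin_B[OF z] by (auto elim!: sandwich_nonzeroE intro: ccontr)
  ultimately show ?thesis unfolding xs der_append3 by (simp add: sandwich_zero)
qed

text \<open>The bracket is the commutator of two derivations, evaluated on the arrow
  \<open>x\<close>. The two halves of the double sum differ by exchanging \<open>f\<close> and
  \<open>g\<close>, so one auxiliary fact serves both.\<close>

lemma bracket1_der:
  assumes f: "f \<in> C1 Q Z" and g: "g \<in> C1 Q Z"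
  shows "bracket1 Q Z f g (x, q) = der_ext f (\<lambda>\<gamma>. g (x, \<gamma>)) q - der_ext g (\<lambda>\<gamma>. f (x, \<gamma>)) q"
proof -
  have *: "(\<Sum>v\<in>Q1B Q Z. \<Sum>u\<in>Q1B Q Z. f u * g v * (if x = fst v then of_nat (occ_count Q Z (snd v) (fst u) (snd u) q) else 0))
     = der_ext f (\<lambda>\<gamma>. g (x, \<gamma>)) q" if f: "f \<in> C1 Q Z" and g: "g \<in> C1 Q Z" for f g :: "_ \<Rightarrow> 'b"
  proof -
    have "(\<Sum>u\<in>Q1B Q Z. f u * g v * (if x = fst v then of_nat (occ_count Q Z (snd v) (fst u) (snd u) q) else 0))
      = (if x = fst v then g v * der f (snd v) q else 0)" if v: "v \<in> Q1B Q Z" for v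
    proof -
      have "is_path Q (snd v)" using v B_path by (auto simp: Q1B_def)
      note o = der_occ_count[OF f this, of q]
      have d: "g v * der f (snd v) q = (\<Sum>u\<in>Q1B Q Z. f u * g v * of_nat (occ_count Q Z (snd v) (fst u) (snd u) q))"
        unfolding o[symmetric] sum_distrib_left by (rule sum.cong) (simp_all add: ac_simps)
      show ?thesis by (cases "x = fst v") (simp_all add: d)
    qed
    then have "(\<Sum>v\<in>Q1B Q Z. \<Sum>u\<in>Q1B Q Z. f u * g v * (if x = fst v then of_nat (occ_count Q Z (snd v) (fst u) (snd u) q) else 0))
      = (\<Sum>v\<in>Q1B Q Z. if x = fst v then g v * der f (snd v) q else 0)" by simp
    also have "\<dots> = (\<Sum>v\<in>Pair x ` B. g v * der f (snd v) q)"
    proof -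
      have "(\<Sum>v\<in>Q1B Q Z. if x = fst v then g v * der f (snd v) q else 0) = (\<Sum>v\<in>{v\<in>Q1B Q Z. x = fst v}. g v * der f (snd v) q)"
        using finite_Q1B by (simp add: sum.inter_filter)
      also have "\<dots> = (\<Sum>v\<in>Pair x ` B. g v * der f (snd v) q)"
        by (rule sum.mono_neutral_left) (use finB g in \<open>auto simp: Q1B_def C1_def\<close>)
      finally show ?thesis .
    qed
    also have "\<dots> = der_ext f (\<lambda>\<gamma>. g (x, \<gamma>)) q"
      unfolding der_ext_def by (subst sum.reindex) (auto simp: inj_on_def)
    finally show ?thesis .
  qed
  have "bracket1 Q Z f g (x, q) =
     (\<Sum>u\<in>Q1B Q Z. \<Sum>v\<in>Q1B Q Z. f u * g v * (if x = fst v then of_nat (occ_count Q Z (snd v) (fst u) (snd u) q) else 0))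
     - (\<Sum>u\<in>Q1B Q Z. \<Sum>v\<in>Q1B Q Z. g v * f u * (if x = fst u then of_nat (occ_count Q Z (snd u) (fst v) (snd v) q) else 0))"
    by (simp add: bracket1_def right_diff_distrib sum_subtractf mult.commute)
  also have "(\<Sum>u\<in>Q1B Q Z. \<Sum>v\<in>Q1B Q Z. f u * g v * (if x = fst v then of_nat (occ_count Q Z (snd v) (fst u) (snd u) q) else 0))
    = (\<Sum>v\<in>Q1B Q Z. \<Sum>u\<in>Q1B Q Z. f u * g v * (if x = fst v then of_nat (occ_count Q Z (snd v) (fst u) (snd u) q) else 0))"
    by (rule sum.swap)
  finally show ?thesis unfolding *[OF f g] *[OF g f] .
qed

text \<open>Commutation with \<open>W\<close>, as a function on arrows.\<close>
definition inner :: "(('v, 'a) qpath \<Rightarrow> 'k::field) \<Rightarrow> 'a \<times> ('v, 'a) qpath \<Rightarrow> 'k" where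
  "inner W = (\<lambda>(a, q). if a \<in> arrs Q
     then sandwich (src Q a, []) W (src Q a, [a]) q - sandwich (src Q a, [a]) W (tgt Q a, []) q else 0)"

section \<open>The image of psi_0 as inner derivations\<close>

lemma psi0_basis_eq:
  "psi0_basis Q Z (e, \<gamma>) (a, q) =
     (if a \<in> arrs Q \<and> src Q a = e \<and> (e, snd \<gamma> @ [a]) \<in> B \<and> q = (e, snd \<gamma> @ [a]) then 1 else 0)
   - (if a \<in> arrs Q \<and> tgt Q a = e \<and> (src Q a, a # snd \<gamma>) \<in> B \<and> q = (src Q a, a # snd \<gamma>) then 1 else 0)"
proof -
  have fin: "finite {b \<in> arrs Q. P b}" for P using fq by (simp add: finite_quiver_def)
  have "(\<Sum>b\<in>{b \<in> arrs Q. src Q b = e}.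
      if (e, snd \<gamma> @ [b]) \<in> B \<and> (a, q) = (b, (e, snd \<gamma> @ [b])) then 1 else 0 :: 'b) =
    (\<Sum>b\<in>{b \<in> arrs Q. src Q b = e}. if b = a then (if (e, snd \<gamma> @ [a]) \<in> B \<and> q = (e, snd \<gamma> @ [a]) then 1 else 0) else 0)"
    by (rule sum.cong) auto
  moreover have "(\<Sum>b\<in>{b \<in> arrs Q. tgt Q b = e}.
      if (src Q b, b # snd \<gamma>) \<in> B \<and> (a, q) = (b, (src Q b, b # snd \<gamma>)) then 1 else 0 :: 'b) =
    (\<Sum>b\<in>{b \<in> arrs Q. tgt Q b = e}. if b = a then (if (src Q a, a # snd \<gamma>) \<in> B \<and> q = (src Q a, a # snd \<gamma>) then 1 else 0) else 0)"
    by (rule sum.cong) auto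
  ultimately show ?thesis
    unfolding psi0_basis_def prod.case using fin by (simp add: sum.delta)
qed

lemma sum_Q0B:
  "(\<Sum>g\<in>Q0B Q Z. h g) = (\<Sum>\<gamma>\<in>B. if pterm Q \<gamma> = fst \<gamma> then h (fst \<gamma>, \<gamma>) else (0::'b::field))"
proof -
  have "Q0B Q Z = (\<lambda>\<gamma>. (fst \<gamma>, \<gamma>)) ` {\<gamma>\<in>B. pterm Q \<gamma> = fst \<gamma>}"
    using B_path by (auto simp: Q0B_def parallel_def is_path_def)
  then have "(\<Sum>g\<in>Q0B Q Z. h g) = (\<Sum>\<gamma>\<in>{\<gamma>\<in>B. pterm Q \<gamma> = fst \<gamma>}. h (fst \<gamma>, \<gamma>))"
    by (simp add: sum.reindex inj_on_def)
  then show ?thesis using finB by (simp add: sum.inter_filter)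
qed

text \<open>In \<open>Q0B\<close> the vertex is the source of its path, so a coefficient family on
  pairs amounts to a function of the path alone.\<close>

lemma sum_psi0_basis:
  "(\<Sum>g\<in>Q0B Q Z. c g * psi0_basis Q Z g (a, q)) = inner (\<lambda>\<gamma>. c (fst \<gamma>, \<gamma>)) (a, q)"
proof (cases "a \<in> arrs Q")
  case False
  then show ?thesis by (auto simp: psi0_basis_eq inner_def intro!: sum.neutral)
next
  case True
  show ?thesis
    unfolding sum_Q0B inner_def sandwich_sum_B prod.case if_P[OF True] sum_subtractf[symmetric]
    by (rule sum.cong) (use True in \<open>auto simp: psi0_basis_eq arrow_pterm\<close>)
qed

text \<open>\<open>W\<close> may be an arbitrary function: the endpoint conditions in
  \<open>sandwich\<close> read it only at closed paths of \<open>B\<close>.\<close>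

lemma ImPsi0_eq: "ImPsi0 Q Z = (range inner :: ('a \<times> ('v, 'a) qpath \<Rightarrow> 'b::field) set)"
proof
  show "ImPsi0 Q Z \<subseteq> (range inner :: ('a \<times> ('v, 'a) qpath \<Rightarrow> 'b) set)"
  proof
    fix f :: "_ \<Rightarrow> 'b" assume "f \<in> ImPsi0 Q Z"
    then obtain c where c: "f = (\<lambda>x. \<Sum>g\<in>Q0B Q Z. c g * psi0_basis Q Z g x)" unfolding ImPsi0_def by blast
    have "f = inner (\<lambda>\<gamma>. c (fst \<gamma>, \<gamma>))"
    proof
      fix x show "f x = inner (\<lambda>\<gamma>. c (fst \<gamma>, \<gamma>)) x"
        unfolding c by (cases x) (simp only: sum_psi0_basis)
    qed
    then show "f \<in> range inner" by blast
  qed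
  show "range inner \<subseteq> (ImPsi0 Q Z :: ('a \<times> ('v, 'a) qpath \<Rightarrow> 'b) set)"
  proof
    fix f :: "_ \<Rightarrow> 'b" assume "f \<in> range inner"
    then obtain W where W: "f = inner W" by blast
    have "f = (\<lambda>x. \<Sum>g\<in>Q0B Q Z. W (snd g) * psi0_basis Q Z g x)"
    proof
      fix x show "f x = (\<Sum>g\<in>Q0B Q Z. W (snd g) * psi0_basis Q Z g x)"
        unfolding W by (cases x) (simp only: sum_psi0_basis snd_conv)
    qed
    then show "f \<in> ImPsi0 Q Z"
      unfolding ImPsi0_def by (intro CollectI exI[of _ "\<lambda>g. W (snd g)"])
  qed
qed

lemma inner_support:
  assumes "inner W (a, q) \<noteq> 0" shows "(a, q) \<in> Q1B Q Z"
proof -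
  have a: "a \<in> arrs Q" and "sandwich (src Q a, []) W (src Q a, [a]) q \<noteq> 0 \<or> sandwich (src Q a, [a]) W (tgt Q a, []) q \<noteq> 0"
    using assms by (auto simp: inner_def split: if_splits)
  then have "q \<in> B \<and> fst q = src Q a \<and> pterm Q q = tgt Q a"
    using sandwich_support[of _ W _ q] by (fastforce simp: arrow_pterm)
  then show ?thesis using a by (auto simp: Q1B_def parallel_def arrow_path_def arrow_pterm)
qed

lemma inner_C1: "inner W \<in> C1 Q Z"
  unfolding C1_def using inner_support by auto

text \<open>Position \<open>i\<close> contributes \<open>W\<close> inserted before arrow
  \<open>i\<close> minus \<open>W\<close> inserted after it. The sum telescopes, so commutation with
  \<open>W\<close> on arrows is commutation with \<open>W\<close> on all paths.\<close>

lemma der_inner: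
  assumes "is_path Q (v, xs)"
  shows "der (inner W) (v, xs) q = sandwich (v, []) W (v, xs) q - sandwich (v, xs) W (pterm Q (v, xs), []) q"
proof -
  let ?s = "\<lambda>i. sandwich (v, take i xs) W (pterm Q (v, take i xs), drop i xs) q"
  have "sandwich (v, take i xs) (\<lambda>\<gamma>. inner W (xs ! i, \<gamma>)) (pterm Q (v, take (Suc i) xs), drop (Suc i) xs) q
     = ?s i - ?s (Suc i)" if i: "i < length xs" for i
  proof -
    note pt = path_nth[OF assms i]
    have a: "xs ! i \<in> arrs Q" using assms i nth_mem by (fastforce simp: is_path_def)
    have "?s i = sandwich (v, take i xs) (sandwich (src Q (xs ! i), []) W (src Q (xs ! i), [xs ! i]))
        (tgt Q (xs ! i), drop (Suc i) xs) q"
      using pt i by (simp add: sandwich_sandwich arrow_pterm Cons_nth_drop_Suc)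
    moreover have "?s (Suc i) = sandwich (v, take i xs) (sandwich (src Q (xs ! i), [xs ! i]) W (tgt Q (xs ! i), []))
        (tgt Q (xs ! i), drop (Suc i) xs) q"
      using pt i by (simp add: sandwich_sandwich take_Suc_conv_app_nth)
    ultimately show ?thesis using a pt by (simp add: inner_def sandwich_diff)
  qed
  then have "der (inner W) (v, xs) q = (\<Sum>i<length xs. ?s i - ?s (Suc i))"
    by (simp add: der_def)
  also have "\<dots> = ?s 0 - ?s (length xs)" by (rule sum_lessThan_telescope')
  finally show ?thesis by simp
qed

lemma inner_KerPsi1: "inner W \<in> KerPsi1 Q Z"
  unfolding KerPsi1_iff
proof (intro conjI inner_C1 ballI allI)
  fix z q assume z: "z \<in> Z"
  have "sandwich (fst z, []) W (fst z, snd z) q = 0" "sandwich (fst z, snd z) W (pterm Q z, []) q = 0"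
    using contains_Z_notin_B[OF z, of "fst z" _ "[]"] contains_Z_notin_B[OF z, of "fst z" "[]"]
    by (auto elim!: sandwich_nonzeroE intro: ccontr)
  then show "der (inner W) z q = 0"
    using der_inner[of "fst z" "snd z" W q] Z_path[OF z] by simp
qed

text \<open>The Leibniz rule for p W r, with the terms D(p) W r and p W D(r) collected in the sum.
  The cocycle condition is used because products p \<delta> r outside \<open>B\<close> are dropped
  on the left, while their derivatives are written out on the right.\<close>

lemma der_ext_sandwich:
  assumes g: "g \<in> KerPsi1 Q Z" and p: "is_path Q p" and r: "is_path Q r"
  shows "der_ext g (sandwich p W r) q =
    (\<Sum>\<delta>\<in>B. if fst \<delta> = pterm Q p \<and> pterm Q \<delta> = fst r then
        W \<delta> * (sandwich (fst p, []) (der g p) (fst \<delta>, snd \<delta> @ snd r) q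
          + sandwich (fst p, snd p @ snd \<delta>) (der g r) (pterm Q r, []) q) else 0)
    + sandwich p (der_ext g W) r q"
proof -
  let ?c = "\<lambda>\<delta>. fst \<delta> = pterm Q p \<and> pterm Q \<delta> = fst r"
  let ?j = "\<lambda>\<delta>. (fst p, snd p @ snd \<delta> @ snd r)"
  have "der_ext g (sandwich p W r) q =
      (\<Sum>\<gamma>\<in>B. \<Sum>\<delta>\<in>B. if \<gamma> = ?j \<delta> then (if ?c \<delta> then W \<delta> * der g (?j \<delta>) q else 0) else 0)"
    unfolding der_ext_def sandwich_sum_B sum_distrib_right
    by (intro sum.cong refl) auto
  also have "\<dots> = (\<Sum>\<delta>\<in>B. \<Sum>\<gamma>\<in>B. if \<gamma> = ?j \<delta> then (if ?c \<delta> then W \<delta> * der g (?j \<delta>) q else 0) else 0)"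
    by (rule sum.swap)
  also have "\<dots> = (\<Sum>\<delta>\<in>B. if ?c \<delta> then W \<delta> * der g (?j \<delta>) q else 0)"
  proof (rule sum.cong[OF refl])
    fix \<delta> assume \<delta>: "\<delta> \<in> B"
    show "(\<Sum>\<gamma>\<in>B. if \<gamma> = ?j \<delta> then (if ?c \<delta> then W \<delta> * der g (?j \<delta>) q else 0) else 0) =
      (if ?c \<delta> then W \<delta> * der g (?j \<delta>) q else 0)"
    proof (cases "?c \<delta> \<and> ?j \<delta> \<notin> B")
      case True
      have "is_path Q (fst p, snd p)" "is_path Q (fst \<delta>, snd \<delta>)" "is_path Q (fst r, snd r)"
        using p r B_path[OF \<delta>] by simp_all
      moreover have "(pterm Q p, snd \<delta>) = \<delta>" using True by (metis prod.collapse)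
      ultimately have "is_path Q (?j \<delta>)" using True by (simp add: is_path_append)
      then have "der g (?j \<delta>) q = 0" using der_notin_B[OF g] True by simp
      then show ?thesis using finB by (simp add: sum.delta)
    next
      case False
      then show ?thesis using finB by (auto simp: sum.delta)
    qed
  qed
  also have "\<dots> = (\<Sum>\<delta>\<in>B. (if ?c \<delta> then
        W \<delta> * (sandwich (fst p, []) (der g p) (fst \<delta>, snd \<delta> @ snd r) q
          + sandwich (fst p, snd p @ snd \<delta>) (der g r) (pterm Q r, []) q) else 0)
      + W \<delta> * sandwich p (der g \<delta>) r q)"
  proof (rule sum.cong[OF refl])
    fix \<delta> assume \<delta>: "\<delta> \<in> B"
    show "(if ?c \<delta> then W \<delta> * der g (?j \<delta>) q else 0) = (if ?c \<delta> then
        W \<delta> * (sandwich (fst p, []) (der g p) (fst \<delta>, snd \<delta> @ snd r) q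
          + sandwich (fst p, snd p @ snd \<delta>) (der g r) (pterm Q r, []) q) else 0)
      + W \<delta> * sandwich p (der g \<delta>) r q"
    proof (cases "?c \<delta>")
      case True
      have 0: "(pterm Q p, snd \<delta>) = \<delta>" using True by (metis prod.collapse)
      have 1: "pterm Q (fst p, snd p) = fst \<delta>" using True by simp
      have 2: "pterm Q (fst p, snd p @ snd \<delta>) = fst r"
        using True by (metis prod.collapse pterm_pair)
      have 3: "pterm Q (fst p, snd p @ snd \<delta> @ snd r) = pterm Q r"
        using 2 by (metis append.assoc prod.collapse pterm_append)
      show ?thesis unfolding der_append3 1 2 3 using True 0 by (simp add: algebra_simps)
    next
      case False
      have "sandwich p (der g \<delta>) r q = 0"
      proof (rule ccontr)
        assume "sandwich p (der g \<delta>) r q \<noteq> 0"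
        then obtain ms where "pterm Q (pterm Q p, ms) = fst r" "der g \<delta> (pterm Q p, ms) \<noteq> 0"
          by (rule sandwich_nonzeroE)
        then show False using der_support[of g \<delta> "(pterm Q p, ms)"] False by auto
      qed
      then show ?thesis unfolding if_not_P[OF False] by simp
    qed
  qed
  finally show ?thesis
    by (simp add: sum.distrib der_ext_def[abs_def] sandwich_sum sandwich_scale)
qed

text \<open>Both sides are the product W G, expanded once along \<open>W\<close> and once along
  \<open>G\<close>.\<close>

lemma sum_sandwich_exchange_right:
  assumes G: "\<And>\<gamma>. G \<gamma> \<noteq> 0 \<Longrightarrow> fst \<gamma> = s \<and> pterm Q \<gamma> = t"
  shows "(\<Sum>\<delta>\<in>B. if fst \<delta> = s \<and> pterm Q \<delta> = s then W \<delta> * sandwich (s, snd \<delta>) G (t, []) q else 0) =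
    (\<Sum>\<gamma>\<in>B. G \<gamma> * sandwich (s, []) W \<gamma> q)"
proof -
  have *: "(if fst \<delta> = s \<and> pterm Q \<delta> = s then W \<delta> * sandwich (s, snd \<delta>) G (t, []) q else 0) =
     (\<Sum>\<gamma>\<in>B. G \<gamma> * (if q \<in> B \<and> fst \<delta> = pterm Q (s, []) \<and> pterm Q \<delta> = fst \<gamma> \<and>
      q = (fst (s, [] :: 'a list), snd (s, []) @ snd \<delta> @ snd \<gamma>) then W \<delta> else 0))" for \<delta>
  proof (cases "fst \<delta> = s \<and> pterm Q \<delta> = s")
    case False
    have "G \<gamma> * (if q \<in> B \<and> fst \<delta> = pterm Q (s, []) \<and> pterm Q \<delta> = fst \<gamma> \<and>
      q = (fst (s, [] :: 'a list), snd (s, []) @ snd \<delta> @ snd \<gamma>) then W \<delta> else 0) = 0" for \<gamma>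
      using False G[of \<gamma>] by (cases "G \<gamma> = 0") auto
    then show ?thesis unfolding if_not_P[OF False] by (metis (no_types, lifting) sum.neutral)
  next
    case True
    then have "pterm Q (s, snd \<delta>) = s" by auto
    then show ?thesis unfolding if_P[OF True] sandwich_sum_B sum_distrib_left
      using True G by (intro sum.cong refl) (auto simp: mult.commute)
  qed
  show ?thesis unfolding * sandwich_sum_B[of "(s, [])" W] sum_distrib_left by (rule sum.swap)
qed

text \<open>The mirror image, for the product G W.\<close>

lemma sum_sandwich_exchange_left:
  assumes G: "\<And>\<gamma>. G \<gamma> \<noteq> 0 \<Longrightarrow> fst \<gamma> = s \<and> pterm Q \<gamma> = t"
  shows "(\<Sum>\<delta>\<in>B. if fst \<delta> = t \<and> pterm Q \<delta> = t then W \<delta> * sandwich (s, []) G (t, snd \<delta>) q else 0) =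
    (\<Sum>\<gamma>\<in>B. G \<gamma> * sandwich \<gamma> W (t, []) q)"
proof -
  have *: "(if fst \<delta> = t \<and> pterm Q \<delta> = t then W \<delta> * sandwich (s, []) G (t, snd \<delta>) q else 0) =
     (\<Sum>\<gamma>\<in>B. G \<gamma> * (if q \<in> B \<and> fst \<delta> = pterm Q \<gamma> \<and> pterm Q \<delta> = fst (t, [] :: 'a list) \<and>
      q = (fst \<gamma>, snd \<gamma> @ snd \<delta> @ snd (t, [])) then W \<delta> else 0))" for \<delta>
  proof (cases "fst \<delta> = t \<and> pterm Q \<delta> = t")
    case False
    have "G \<gamma> * (if q \<in> B \<and> fst \<delta> = pterm Q \<gamma> \<and> pterm Q \<delta> = fst (t, [] :: 'a list) \<and>
      q = (fst \<gamma>, snd \<gamma> @ snd \<delta> @ snd (t, [])) then W \<delta> else 0) = 0" for \<gamma>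
      using False G[of \<gamma>] by (cases "G \<gamma> = 0") auto
    then show ?thesis unfolding if_not_P[OF False] by (metis (no_types, lifting) sum.neutral)
  next
    case True
    then show ?thesis unfolding if_P[OF True] sandwich_sum_B sum_distrib_left
      using True G by (intro sum.cong refl) (auto simp: mult.commute)
  qed
  show ?thesis unfolding * sandwich_sum_B[of _ W "(t, [])"] sum_distrib_left by (rule sum.swap)
qed

text \<open>The identity [ad W, D] = - ad (D W), compared on an arrow x: in D(W x - x W) the terms W
  D(x) and D(x) W cancel against ad W applied to D(x).\<close>

lemma bracket1_inner:
  assumes g: "g \<in> KerPsi1 Q Z"
  shows "bracket1 Q Z (inner W) g = inner (\<lambda>q. - der_ext g W q)"
proof
  fix xq :: "'a \<times> ('v, 'a) qpath"
  obtain x q where xq: "xq = (x, q)" by (cases xq)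
  have gC: "g \<in> C1 Q Z" using g by (simp add: KerPsi1_iff)
  note br = bracket1_der[OF inner_C1 gC, of W x q]
  show "bracket1 Q Z (inner W) g xq = inner (\<lambda>q. - der_ext g W q) xq"
  proof (cases "x \<in> arrs Q")
    case False
    then have "g (x, \<gamma>) = 0" "inner W (x, \<gamma>) = 0" for \<gamma>
      using C1_support(1)[OF gC, of x \<gamma>] by (auto simp: inner_def)
    then show ?thesis using br xq False by (simp add: der_ext_def inner_def)
  next
    case x: True
    let ?s = "src Q x" and ?t = "tgt Q x" and ?G = "\<lambda>\<gamma>. g (x, \<gamma>)"
    have st: "is_path Q (?s, [])" "is_path Q (?t, [])" "is_path Q (?s, [x])"
      using x fq by (auto simp: is_path_Cons finite_quiver_def)
    have G: "fst \<gamma> = ?s \<and> pterm Q \<gamma> = ?t" if "?G \<gamma> \<noteq> 0" for \<gamma>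
      using C1_support(3,4)[OF gC that] by blast
    have "der_ext (inner W) ?G q = (\<Sum>\<gamma>\<in>B. ?G \<gamma> * sandwich (?s, []) W \<gamma> q - ?G \<gamma> * sandwich \<gamma> W (?t, []) q)"
      unfolding der_ext_def
    proof (rule sum.cong[OF refl])
      fix \<gamma> assume \<gamma>: "\<gamma> \<in> B"
      show "?G \<gamma> * der (inner W) \<gamma> q = ?G \<gamma> * sandwich (?s, []) W \<gamma> q - ?G \<gamma> * sandwich \<gamma> W (?t, []) q"
      proof (cases "?G \<gamma> = 0")
        case False
        have "\<gamma> = (?s, snd \<gamma>)" "pterm Q \<gamma> = ?t" using G[OF False] by (auto simp: prod_eq_iff)
        then have "der (inner W) \<gamma> q = sandwich (?s, []) W \<gamma> q - sandwich \<gamma> W (?t, []) q"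
          using der_inner[of ?s "snd \<gamma>" W q] B_path[OF \<gamma>] by simp
        then show ?thesis by (simp add: right_diff_distrib)
      qed simp
    qed
    also have "\<dots> = (\<Sum>\<gamma>\<in>B. ?G \<gamma> * sandwich (?s, []) W \<gamma> q) - (\<Sum>\<gamma>\<in>B. ?G \<gamma> * sandwich \<gamma> W (?t, []) q)"
      by (rule sum_subtractf)
    finally have 1: "der_ext (inner W) ?G q = \<dots>" .
    have "der_ext g (\<lambda>\<gamma>. inner W (x, \<gamma>)) q =
       der_ext g (sandwich (?s, []) W (?s, [x])) q - der_ext g (sandwich (?s, [x]) W (?t, [])) q"
      using x by (simp add: inner_def der_ext_def left_diff_distrib sum_subtractf)
    also have "der_ext g (sandwich (?s, []) W (?s, [x])) q =
       (\<Sum>\<gamma>\<in>B. ?G \<gamma> * sandwich (?s, []) W \<gamma> q) + sandwich (?s, []) (der_ext g W) (?s, [x]) q"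
      unfolding der_ext_sandwich[OF g st(1,3)]
      using sum_sandwich_exchange_right[of ?G ?s ?t W q, OF G]
      by (simp add: der_Nil sandwich_zero der_arrow[OF gC] arrow_pterm cong: if_cong)
    also have "der_ext g (sandwich (?s, [x]) W (?t, [])) q =
       (\<Sum>\<gamma>\<in>B. ?G \<gamma> * sandwich \<gamma> W (?t, []) q) + sandwich (?s, [x]) (der_ext g W) (?t, []) q"
    proof -
      have e: "(if fst \<delta> = ?t \<and> pterm Q \<delta> = ?t then W \<delta> * sandwich (?s, []) ?G (fst \<delta>, snd \<delta>) q else 0) =
        (if fst \<delta> = ?t \<and> pterm Q \<delta> = ?t then W \<delta> * sandwich (?s, []) ?G (?t, snd \<delta>) q else 0)" for \<delta>
        by auto
      show ?thesis
        unfolding der_ext_sandwich[OF g st(3,2)]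
        using sum_sandwich_exchange_left[of ?G ?s ?t W q, OF G, unfolded e[symmetric]]
        by (simp add: der_Nil sandwich_zero der_arrow[OF gC] arrow_pterm cong: if_cong)
    qed
    finally show ?thesis
      unfolding xq br 1 using x by (simp add: inner_def sandwich_minus)
  qed
qed

end

section \<open>Operations on cosets are well defined\<close>

lemma cosetI: "w \<in> W \<Longrightarrow> h = (\<lambda>x. f x + w x) \<Longrightarrow> h \<in> coset W f"
  by (auto simp: coset_def)

lemma coset_add:
  assumes "(\<lambda>_. 0) \<in> W" "\<And>u w. u \<in> W \<Longrightarrow> w \<in> W \<Longrightarrow> (\<lambda>x. u x + w x) \<in> W"
  shows "{(\<lambda>x. f' x + g' x) | f' g'. f' \<in> coset W f \<and> g' \<in> coset W g} = coset W (\<lambda>x. f x + g x)"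
proof (intro equalityI subsetI)
  fix h assume "h \<in> {(\<lambda>x. f' x + g' x) | f' g'. f' \<in> coset W f \<and> g' \<in> coset W g}"
  then obtain u w where uw: "u \<in> W" "w \<in> W" "h = (\<lambda>x. (f x + u x) + (g x + w x))"
    unfolding coset_def by blast
  then have "h = (\<lambda>x. (f x + g x) + (u x + w x))" by (simp add: algebra_simps)
  then show "h \<in> coset W (\<lambda>x. f x + g x)" by (rule cosetI[OF assms(2)[OF uw(1,2)]])
next
  fix h assume "h \<in> coset W (\<lambda>x. f x + g x)"
  then obtain w where w: "w \<in> W" "h = (\<lambda>x. (f x + g x) + w x)" unfolding coset_def by blast
  have 1: "(\<lambda>x. f x + 0) \<in> coset W f" and 2: "(\<lambda>x. g x + w x) \<in> coset W g"
    by (rule cosetI[OF assms(1) refl], rule cosetI[OF w(1) refl])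
  have 3: "h = (\<lambda>x. (f x + 0) + (g x + w x))" using w(2) by (simp add: algebra_simps)
  show "h \<in> {(\<lambda>x. f' x + g' x) | f' g'. f' \<in> coset W f \<and> g' \<in> coset W g}"
    by (rule CollectI, rule exI, rule exI, intro conjI) (rule 3, rule 1, rule 2)
qed

text \<open>The extra summand \<open>w\<close> matters at \<open>s = 0\<close>, where it makes the
  result all of \<open>W\<close> rather than the zero function alone.\<close>

lemma coset_scale:
  assumes "(\<lambda>_. 0) \<in> W" "\<And>u w. u \<in> W \<Longrightarrow> w \<in> W \<Longrightarrow> (\<lambda>x. u x + w x) \<in> W"
    and "\<And>w. w \<in> W \<Longrightarrow> (\<lambda>x. s * w x) \<in> W"
  shows "{(\<lambda>x. s * f' x + w x) | f' w. f' \<in> coset W f \<and> w \<in> W} = coset W (\<lambda>x. s * f x)"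
proof (intro equalityI subsetI)
  fix h assume "h \<in> {(\<lambda>x. s * f' x + w x) | f' w. f' \<in> coset W f \<and> w \<in> W}"
  then obtain u w where uw: "u \<in> W" "w \<in> W" "h = (\<lambda>x. s * (f x + u x) + w x)"
    unfolding coset_def by blast
  then have "h = (\<lambda>x. s * f x + (s * u x + w x))" by (simp add: algebra_simps)
  then show "h \<in> coset W (\<lambda>x. s * f x)" by (rule cosetI[OF assms(2)[OF assms(3)[OF uw(1)] uw(2)]])
next
  fix h assume "h \<in> coset W (\<lambda>x. s * f x)"
  then obtain w where w: "w \<in> W" "h = (\<lambda>x. s * f x + w x)" unfolding coset_def by blast
  have 1: "(\<lambda>x. f x + 0) \<in> coset W f" by (rule cosetI[OF assms(1) refl])
  have 2: "h = (\<lambda>x. s * (f x + 0) + w x)" using w(2) by simp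
  show "h \<in> {(\<lambda>x. s * f' x + w x) | f' w. f' \<in> coset W f \<and> w \<in> W}"
    by (rule CollectI, rule exI, rule exI, intro conjI) (rule 2, rule 1, rule w(1))
qed

lemma bracket1_add_left: "bracket1 Q Z (\<lambda>x. f x + g x) h y = bracket1 Q Z f h y + bracket1 Q Z g h y"
  by (cases y) (simp add: bracket1_def distrib_right sum.distrib)

text \<open>Reduces additivity and the ideal property in the right argument to those in the left
  one.\<close>

lemma bracket1_swap: "bracket1 Q Z g f y = - bracket1 Q Z f g y"
proof -
  obtain x q where Pair: "y = (x, q)" by (cases y)
  have "bracket1 Q Z g f y = (\<Sum>v\<in>Q1B Q Z. \<Sum>u\<in>Q1B Q Z. g u * f v *
      ((if x = fst v then of_nat (occ_count Q Z (snd v) (fst u) (snd u) q) else 0)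
     - (if x = fst u then of_nat (occ_count Q Z (snd u) (fst v) (snd v) q) else 0)))"
    unfolding Pair bracket1_def prod.case by (rule sum.swap)
  also have "\<dots> = - bracket1 Q Z f g y"
    unfolding Pair bracket1_def prod.case sum_negf[symmetric]
    by (intro sum.cong refl) (simp add: algebra_simps)
  finally show ?thesis .
qed

lemma bracket1_add_right: "bracket1 Q Z h (\<lambda>x. f x + g x) y = bracket1 Q Z h f y + bracket1 Q Z h g y"
  by (subst (1 2 3) bracket1_swap) (simp add: bracket1_add_left)

context monomial_quiver
begin

lemma inner_add: "inner (\<lambda>q. V q + W q) = (\<lambda>x. inner V x + inner W x)"
  by (auto simp: inner_def sandwich_add)

lemma inner_scale: "inner (\<lambda>q. s * W q) = (\<lambda>x. s * inner W x)"
  by (auto simp: inner_def sandwich_scale right_diff_distrib)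

lemma ImPsi0_zero: "(\<lambda>_. 0::'k::field) \<in> ImPsi0 Q Z"
proof -
  have "inner (\<lambda>_. 0::'k) = (\<lambda>_. 0)" by (auto simp: inner_def sandwich_zero)
  then show ?thesis unfolding ImPsi0_eq by (intro range_eqI[where x = "\<lambda>_. 0"]) simp
qed

lemma ImPsi0_add: "u \<in> ImPsi0 Q Z \<Longrightarrow> w \<in> ImPsi0 Q Z \<Longrightarrow> (\<lambda>x. u x + w x) \<in> ImPsi0 Q Z"
  unfolding ImPsi0_eq by (elim rangeE) (simp flip: inner_add)

lemma ImPsi0_scale: "w \<in> ImPsi0 Q Z \<Longrightarrow> (\<lambda>x. s * w x) \<in> ImPsi0 Q Z"
  unfolding ImPsi0_eq by (elim rangeE) (simp flip: inner_scale)

lemma ImPsi0_Ker: "w \<in> ImPsi0 Q Z \<Longrightarrow> w \<in> KerPsi1 Q Z"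
  unfolding ImPsi0_eq using inner_KerPsi1 by blast

lemma bracket1_ImPsi0_left:
  assumes "w \<in> ImPsi0 Q Z" "g \<in> KerPsi1 Q Z" shows "bracket1 Q Z w g \<in> ImPsi0 Q Z"
  using assms(1) unfolding ImPsi0_eq by (elim rangeE) (simp add: bracket1_inner[OF assms(2)])

lemma bracket1_ImPsi0_right:
  assumes "w \<in> ImPsi0 Q Z" "g \<in> KerPsi1 Q Z" shows "bracket1 Q Z g w \<in> ImPsi0 Q Z"
proof -
  have "bracket1 Q Z g w = (\<lambda>x. (-1) * bracket1 Q Z w g x)" using bracket1_swap[of Q Z g w] by auto
  then show ?thesis using ImPsi0_scale[OF bracket1_ImPsi0_left[OF assms], of "-1"] by simp
qed

text \<open>Changing representatives by \<open>u\<close> and \<open>v\<close> changes the bracket by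
  [f, v] + [u, g] + [u, v], and each term lies in the ideal.\<close>

lemma coset_bracket1:
  assumes f: "f \<in> KerPsi1 Q Z" and g: "g \<in> KerPsi1 Q Z"
  shows "{(\<lambda>x. bracket1 Q Z f' g' x + w x) | f' g' w.
      f' \<in> coset (ImPsi0 Q Z) f \<and> g' \<in> coset (ImPsi0 Q Z) g \<and> w \<in> ImPsi0 Q Z}
    = coset (ImPsi0 Q Z) (bracket1 Q Z f g)"
proof (intro equalityI subsetI)
  fix h assume "h \<in> {(\<lambda>x. bracket1 Q Z f' g' x + w x) | f' g' w.
      f' \<in> coset (ImPsi0 Q Z) f \<and> g' \<in> coset (ImPsi0 Q Z) g \<and> w \<in> ImPsi0 Q Z}"
  then obtain u v w where W: "u \<in> ImPsi0 Q Z" "v \<in> ImPsi0 Q Z" "w \<in> ImPsi0 Q Z"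
    and h: "h = (\<lambda>x. bracket1 Q Z (\<lambda>x. f x + u x) (\<lambda>x. g x + v x) x + w x)"
    unfolding coset_def by blast
  have "h = (\<lambda>x. bracket1 Q Z f g x +
      (((bracket1 Q Z f v x + bracket1 Q Z u g x) + bracket1 Q Z u v x) + w x))"
    unfolding h by (simp add: bracket1_add_left bracket1_add_right algebra_simps)
  moreover have "(\<lambda>x. ((bracket1 Q Z f v x + bracket1 Q Z u g x) + bracket1 Q Z u v x) + w x) \<in> ImPsi0 Q Z"
    by (intro ImPsi0_add bracket1_ImPsi0_left bracket1_ImPsi0_right W f g ImPsi0_Ker)
  ultimately show "h \<in> coset (ImPsi0 Q Z) (bracket1 Q Z f g)" using cosetI by blast
next
  fix h assume "h \<in> coset (ImPsi0 Q Z) (bracket1 Q Z f g)"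
  then obtain w where w: "w \<in> ImPsi0 Q Z" "h = (\<lambda>x. bracket1 Q Z f g x + w x)"
    unfolding coset_def by blast
  have "f \<in> coset (ImPsi0 Q Z) f" "g \<in> coset (ImPsi0 Q Z) g"
    unfolding coset_def using ImPsi0_zero by force+
  then show "h \<in> {(\<lambda>x. bracket1 Q Z f' g' x + w x) | f' g' w.
      f' \<in> coset (ImPsi0 Q Z) f \<and> g' \<in> coset (ImPsi0 Q Z) g \<and> w \<in> ImPsi0 Q Z}"
    using w by blast
qed

section \<open>Arrows and matrices\<close>

lemma parallel_arrows: "parallel Q (arrow_path Q a) (arrow_path Q b) \<longleftrightarrow> src Q a = src Q b \<and> tgt Q a = tgt Q b"
  by (simp add: parallel_def arrow_path_def arrow_pterm)

lemma arrow_in_B: "a \<in> arrs Q \<Longrightarrow> arrow_path Q a \<in> B"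
proof -
  assume a: "a \<in> arrs Q"
  have "\<not> subpath Q z (arrow_path Q a)" if "z \<in> Z" for z
    using Z_length[OF that] unfolding subpath_def arrow_path_def
    by (auto dest!: arg_cong[of _ _ length])
  then show ?thesis
    using a fq by (auto simp: Bpaths_def arrow_path_def is_path_Cons finite_quiver_def)
qed

lemma repl_arrow: "i < length (snd p) \<Longrightarrow> repl p i (arrow_path Q b) = (fst p, (snd p)[i := b])"
  by (simp add: repl_def arrow_path_def upd_conv_take_nth_drop)

lemma Z_notin_B: "z \<in> Z \<Longrightarrow> z \<notin> B"
  using contains_Z_notin_B[of z "fst z" "[]" "[]"] by simp

text \<open>Replacing \<open>a\<close> by a different arrow at two different positions gives
  different paths, so every coefficient is 0 or 1 and its vanishing does not depend on the
  characteristic.\<close>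

lemma leZ_iff: "leZ TYPE('k::field) Q Z b a \<longleftrightarrow>
    (\<forall>p\<in>Z. \<forall>i<length (snd p). snd p ! i = a \<longrightarrow> (fst p, (snd p)[i := b]) \<notin> B)"
proof -
  have "(\<forall>q. (of_nat (occ_count Q Z p a (arrow_path Q b) q) :: 'k) = 0) \<longleftrightarrow>
     (\<forall>i<length (snd p). snd p ! i = a \<longrightarrow> (fst p, (snd p)[i := b]) \<notin> B)" (is "?L \<longleftrightarrow> ?R")
    if p: "p \<in> Z" for p
  proof
    let ?I = "\<lambda>q. {i. i < length (snd p) \<and> snd p ! i = a \<and> repl p i (arrow_path Q b) = q}"
    show ?L if R: ?R
    proof
      fix q
      have "occ_count Q Z p a (arrow_path Q b) q = 0"
      proof (cases "q \<in> B")
        case True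
        then have "?I q = {}" using R repl_arrow by fastforce
        then show ?thesis unfolding occ_count_def by (simp only: card.empty) simp
      qed (simp add: occ_count_def)
      then show "(of_nat (occ_count Q Z p a (arrow_path Q b) q) :: 'k) = 0" by simp
    qed
    show ?R if L: ?L
    proof (intro allI impI notI)
      fix i assume i: "i < length (snd p)" "snd p ! i = a" and q: "(fst p, (snd p)[i := b]) \<in> B"
      \<comment> \<open>For \<open>b = a\<close> the replacement would return the relation
        \<open>p\<close>, which is not in \<open>B\<close>.\<close>
      have ab: "a \<noteq> b" using q i Z_notin_B[OF p] by auto
      have "j = i" if j: "j < length (snd p)" "snd p ! j = a" "(snd p)[j := b] = (snd p)[i := b]" for j
      proof (rule ccontr)
        assume "j \<noteq> i"
        then have "(snd p)[j := b] ! i = a" using i by simp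
        then show False using j(3) i ab by simp
      qed
      then have "?I (fst p, (snd p)[i := b]) = {i}" using i by (auto simp: repl_arrow)
      then have "occ_count Q Z p a (arrow_path Q b) (fst p, (snd p)[i := b]) = 1"
        using q unfolding occ_count_def by (simp only: card.insert) simp
      then show False using L by (metis of_nat_1 zero_neq_one)
    qed
  qed
  then show ?thesis unfolding leZ_def by blast
qed

definition arrow_le :: "'k::field itself \<Rightarrow> 'a \<Rightarrow> 'a \<Rightarrow> bool" where
  "arrow_le K b a \<longleftrightarrow> a \<in> arrs Q \<and> b \<in> arrs Q \<and> src Q a = src Q b \<and> tgt Q a = tgt Q b \<and> leZ K Q Z b a"

lemma arrow_le_refl: "a \<in> arrs Q \<Longrightarrow> arrow_le TYPE('k::field) a a"
proof -
  have "(fst p, (snd p)[i := snd p ! i]) \<notin> B" if "p \<in> Z" for p i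
    using Z_notin_B[OF that] by simp
  then show "a \<in> arrs Q \<Longrightarrow> arrow_le TYPE('k::field) a a" unfolding arrow_le_def leZ_iff by auto
qed

lemma is_path_update:
  assumes "is_path Q (v, xs)" "i < length xs" "b \<in> arrs Q" "src Q (xs ! i) = src Q b" "tgt Q (xs ! i) = tgt Q b"
  shows "is_path Q (v, xs[i := b])"
proof -
  have "is_path Q (v, take i xs @ (xs ! i) # drop (Suc i) xs)"
    using assms id_take_nth_drop[OF assms(2)] by simp
  then show ?thesis
    unfolding upd_conv_take_nth_drop[OF assms(2)] using assms(3-5) by (simp add: is_path_append is_path_Cons)
qed

text \<open>Putting \<open>b\<close> for \<open>a\<close> in a relation produces a path that
  contains some relation \<open>z\<close>. If \<open>z\<close> misses the changed position, it is
  still there after putting \<open>c\<close>; otherwise \<open>z\<close> has \<open>b\<close> at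
  that position, and \<open>c\<close> below \<open>b\<close> keeps the changed \<open>z\<close>
  outside \<open>B\<close>.\<close>

lemma arrow_le_trans:
  assumes cb: "arrow_le TYPE('k::field) c b" and ba: "arrow_le TYPE('k) b a"
  shows "arrow_le TYPE('k) c a"
proof -
  have "(fst p, (snd p)[i := c]) \<notin> B" if p: "p \<in> Z" and i: "i < length (snd p)" "snd p ! i = a" for p i
  proof
    assume B': "(fst p, (snd p)[i := c]) \<in> B"
    have "is_path Q (fst p, (snd p)[i := b])"
      by (rule is_path_update) (use Z_path[OF p] ba i in \<open>auto simp: arrow_le_def\<close>)
    moreover have "(fst p, (snd p)[i := b]) \<notin> B" using ba p i by (auto simp: arrow_le_def leZ_iff)
    ultimately obtain us z ws where z: "z \<in> Z" and e: "(snd p)[i := b] = us @ snd z @ ws"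
      by (rule not_B_obtains)
    have c: "(snd p)[i := c] = (us @ snd z @ ws)[i := c]"
      using e by (metis list_update_overwrite)
    have len: "length (snd p) = length us + length (snd z) + length ws"
      using arg_cong[OF e, of length] by simp
    consider "i < length us" | "length us \<le> i" "i < length us + length (snd z)"
      | "length us + length (snd z) \<le> i" by linarith
    then show False
    proof cases
      case 1
      then have "(snd p)[i := c] = us[i := c] @ snd z @ ws" using c by (simp add: list_update_append)
      then show False using B' contains_Z_notin_B[OF z] by simp
    next
      case 3
      then have "(snd p)[i := c] = us @ snd z @ ws[i - length us - length (snd z) := c]"
        using c by (auto simp: list_update_append)
      then show False using B' contains_Z_notin_B[OF z] by simp
    next
      case 2
      define j where "j = i - length us"
      have j: "j < length (snd z)" "i = length us + j" using 2 by (auto simp: j_def)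
      have "(us @ snd z @ ws) ! i = b" using e i(1) by (metis nth_list_update_eq)
      then have zj: "snd z ! j = b" using j by (simp add: nth_append)
      have "(snd p)[i := c] = us @ (snd z)[j := c] @ ws"
        using c j by (simp add: list_update_append)
      then have "(pterm Q (fst p, us), (snd z)[j := c]) \<in> B" using B' B_infix by simp
      moreover have "pterm Q (fst p, us) = fst z"
      proof -
        have "is_path Q (fst p, us @ snd z @ ws)"
          using \<open>is_path Q (fst p, (snd p)[i := b])\<close> e by simp
        then have 1: "is_path Q (pterm Q (fst p, us), snd z)" by (simp add: is_path_append)
        obtain y ys where "snd z = y # ys" using Z_length[OF z] by (cases "snd z") auto
        moreover have "is_path Q (fst z, snd z)" using Z_path[OF z] by simp
        ultimately show ?thesis using 1 by (simp add: is_path_Cons)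
      qed
      ultimately show False using cb z j(1) zj by (auto simp: arrow_le_def leZ_iff)
    qed
  qed
  then show ?thesis using assms by (auto simp: arrow_le_def leZ_iff)
qed

text \<open>The pair \<open>(a, b)\<close> corresponds to the matrix unit with row \<open>b\<close> and column \<open>a\<close>.\<close>
definition of_mat :: "('a, 'k::field) mat \<Rightarrow> 'a \<times> ('v, 'a) qpath \<Rightarrow> 'k" where
  "of_mat M = (\<lambda>(a, q). if (a, q) \<in> Q1Q1 Q then M (hd (snd q)) a else 0)"

abbreviation "arrow_mats \<equiv> (supported (arrow_le TYPE('k::field)) :: ('a, 'k) mat set)"

section \<open>Cocycles on pairs of parallel arrows as matrices\<close>

lemma Q1Q1_arrow: "(a, arrow_path Q b) \<in> Q1Q1 Q \<longleftrightarrow>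
    a \<in> arrs Q \<and> b \<in> arrs Q \<and> src Q a = src Q b \<and> tgt Q a = tgt Q b"
  by (auto simp: Q1Q1_def parallel_arrows) (auto simp: arrow_path_def)

lemma of_mat_arrow: "M \<in> arrow_mats \<Longrightarrow> of_mat M (a, arrow_path Q b) = M b a"
  unfolding of_mat_def prod.case Q1Q1_arrow
  by (auto simp: arrow_path_def supported_def arrow_le_def)

lemma of_mat_support:
  assumes "of_mat M (a, q) \<noteq> 0"
  obtains b where "q = arrow_path Q b" "M b a \<noteq> 0" "a \<in> arrs Q" "b \<in> arrs Q" "src Q a = src Q b" "tgt Q a = tgt Q b"
proof -
  have q: "(a, q) \<in> Q1Q1 Q" "M (hd (snd q)) a \<noteq> 0" using assms by (auto simp: of_mat_def split: if_splits)
  then obtain b where b: "q = arrow_path Q b" by (auto simp: Q1Q1_def)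
  show thesis using that[OF b] q Q1Q1_arrow b by (simp add: arrow_path_def)
qed

lemma Q1Q1_sub: "Q1Q1 Q \<subseteq> Q1B Q Z"
  using arrow_in_B by (auto simp: Q1Q1_def Q1B_def)

lemma of_mat_C1: "of_mat M \<in> C1 Q Z"
  using Q1Q1_sub by (auto simp: C1_def of_mat_def split: if_splits)

text \<open>A nonzero term of the derivation at a relation would give a path of \<open>B\<close>
  obtained by a replacement that \<open>arrow_le\<close> excludes.\<close>

lemma of_mat_V0:
  fixes M :: "('a, 'k::field) mat"
  assumes M: "M \<in> arrow_mats" shows "of_mat M \<in> V0 Q Z"
proof -
  have "der (of_mat M) p q = 0" if p: "p \<in> Z" for p q
    unfolding der_def
  proof (rule sum.neutral, rule ballI, rule ccontr)
    fix i assume i: "i \<in> {..<length (snd p)}"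
      and nz: "sandwich (fst p, take i (snd p)) (\<lambda>\<gamma>. of_mat M (snd p ! i, \<gamma>))
          (pterm Q (fst p, take (Suc i) (snd p)), drop (Suc i) (snd p)) q \<noteq> 0"
    then obtain ms where ms: "q \<in> B" "q = (fst p, take i (snd p) @ ms @ drop (Suc i) (snd p))"
      "of_mat M (snd p ! i, (pterm Q (fst p, take i (snd p)), ms)) \<noteq> 0"
      by (elim sandwich_nonzeroE) auto
    from ms(3) obtain b where b: "(pterm Q (fst p, take i (snd p)), ms) = arrow_path Q b" "M b (snd p ! i) \<noteq> 0"
      by (rule of_mat_support)
    have "arrow_le TYPE('k) b (snd p ! i)" using b(2) M by (auto simp: supported_def)
    then have "(fst p, (snd p)[i := b]) \<notin> B" using p i by (auto simp: arrow_le_def leZ_iff)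
    then show False using ms(1,2) b(1) i by (simp add: arrow_path_def upd_conv_take_nth_drop)
  qed
  then have "of_mat M \<in> KerPsi1 Q Z" unfolding KerPsi1_iff using of_mat_C1 by blast
  then show ?thesis by (auto simp: V0_def of_mat_def split: if_splits)
qed

text \<open>The coefficient of one path in D(p) isolates f(a, b): replacing an arrow at any other
  position keeps \<open>a\<close> at position \<open>i\<close>, where this path has
  \<open>b\<close>. Hence the kernel condition decouples into conditions on single pairs.\<close>

lemma V0_arrow_le:
  fixes f :: "_ \<Rightarrow> 'k::field"
  assumes f: "f \<in> V0 Q Z" and nz: "f (a, arrow_path Q b) \<noteq> 0"
  shows "arrow_le TYPE('k) b a"
proof -
  have par: "a \<in> arrs Q" "b \<in> arrs Q" "src Q a = src Q b" "tgt Q a = tgt Q b"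
    using f nz Q1Q1_arrow unfolding V0_def by blast+
  have K: "f \<in> KerPsi1 Q Z" and S: "\<And>x. f x \<noteq> 0 \<Longrightarrow> x \<in> Q1Q1 Q" using f by (auto simp: V0_def)
  have "(fst p, (snd p)[i := b]) \<notin> B" if p: "p \<in> Z" and i: "i < length (snd p)" "snd p ! i = a" for p i
  proof
    let ?q = "(fst p, (snd p)[i := b])"
    let ?t = "\<lambda>j. sandwich (fst p, take j (snd p)) (\<lambda>\<gamma>. f (snd p ! j, \<gamma>))
          (pterm Q (fst p, take (Suc j) (snd p)), drop (Suc j) (snd p)) ?q"
    assume q: "?q \<in> B"
    have ab: "a \<noteq> b" using q i Z_notin_B[OF p] by auto
    have pp: "is_path Q (fst p, snd p)" using Z_path[OF p] by simp
    have "?t j = 0" if j: "j < length (snd p)" "j \<noteq> i" for j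
    proof (rule ccontr)
      assume "?t j \<noteq> 0"
      then obtain ms where ms: "(snd p)[i := b] = take j (snd p) @ ms @ drop (Suc j) (snd p)"
        "f (snd p ! j, (pterm Q (fst p, take j (snd p)), ms)) \<noteq> 0"
        by (elim sandwich_nonzeroE) auto
      from S[OF ms(2)] obtain b' where "ms = [b']" by (auto simp: Q1Q1_def arrow_path_def)
      then have "(snd p)[i := b] = (snd p)[j := b']" using ms(1) j by (simp add: upd_conv_take_nth_drop)
      then have "(snd p)[i := b] ! i = (snd p)[j := b'] ! i" by simp
      then show False using i j ab by simp
    qed
    then have "der f p ?q = (\<Sum>j<length (snd p). if j = i then ?t i else 0)"
      unfolding der_def by (intro sum.cong refl) auto
    also have "\<dots> = ?t i" using i by (simp add: sum.delta)
    also have "\<dots> = f (a, arrow_path Q b)"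
    proof -
      note pt = path_nth[OF pp i(1)]
      have "sandwich (fst p, take i (snd p)) (\<lambda>\<gamma>. f (snd p ! i, \<gamma>)) (tgt Q a, drop (Suc i) (snd p))
         (fst p, take i (snd p) @ [b] @ drop (Suc i) (snd p)) = f (a, (src Q a, [b]))"
        using sandwich_eq[of "(fst p, take i (snd p))" "[b]" "(tgt Q a, drop (Suc i) (snd p))" "\<lambda>\<gamma>. f (snd p ! i, \<gamma>)"]
          q i pt par by (simp add: upd_conv_take_nth_drop arrow_pterm)
      then show ?thesis using pt i par by (simp add: upd_conv_take_nth_drop arrow_path_def)
    qed
    finally show False using nz K p by (auto simp: KerPsi1_iff)
  qed
  then show ?thesis using par by (auto simp: arrow_le_def leZ_iff)
qed

lemma V0_eq: "V0 Q Z = of_mat ` (arrow_mats :: ('a, 'k::field) mat set)"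
proof (intro equalityI subsetI)
  fix f :: "'a \<times> ('v, 'a) qpath \<Rightarrow> 'k" assume f: "f \<in> V0 Q Z"
  define M where "M = (\<lambda>b a. f (a, arrow_path Q b))"
  have M: "M \<in> arrow_mats" using V0_arrow_le[OF f] by (simp add: supported_def M_def)
  have "f (a, q) = of_mat M (a, q)" for a q
  proof (cases "(a, q) \<in> Q1Q1 Q")
    case True
    then obtain b where b: "q = arrow_path Q b" by (auto simp: Q1Q1_def)
    then show ?thesis using of_mat_arrow[OF M] by (simp add: M_def)
  next
    case False
    then have "f (a, q) = 0" using f unfolding V0_def by blast
    then show ?thesis using False by (simp add: of_mat_def)
  qed
  then have "f = of_mat M" by auto
  then show "f \<in> of_mat ` arrow_mats" using M by blast
qed (use of_mat_V0 in blast)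

lemma finA: "finite (arrs Q)"
  using fq by (simp add: finite_quiver_def)

lemma der_ext_of_mat:
  assumes M: "M \<in> arrow_mats" and N: "N \<in> (arrow_mats :: ('a, 'k::field) mat set)"
  shows "der_ext (of_mat M) (\<lambda>\<gamma>. of_mat N (x, \<gamma>)) q = (\<Sum>b\<in>arrs Q. of_mat M (b, q) * N b x)"
proof -
  have "der_ext (of_mat M) (\<lambda>\<gamma>. of_mat N (x, \<gamma>)) q = (\<Sum>\<gamma>\<in>arrow_path Q ` arrs Q. of_mat N (x, \<gamma>) * der (of_mat M) \<gamma> q)"
    unfolding der_ext_def
  proof (rule sum.mono_neutral_right[OF finB])
    show "arrow_path Q ` arrs Q \<subseteq> B" using arrow_in_B by blast
    show "\<forall>\<gamma>\<in>B - arrow_path Q ` arrs Q. of_mat N (x, \<gamma>) * der (of_mat M) \<gamma> q = 0"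
      using of_mat_support[of N x] by (metis DiffD2 imageI mult_zero_left)
  qed
  also have "\<dots> = (\<Sum>b\<in>arrs Q. of_mat N (x, arrow_path Q b) * der (of_mat M) (arrow_path Q b) q)"
    by (subst sum.reindex) (auto simp: inj_on_def arrow_path_def)
  also have "\<dots> = (\<Sum>b\<in>arrs Q. of_mat M (b, q) * N b x)"
    unfolding of_mat_arrow[OF N] by (simp add: arrow_path_def der_arrow[OF of_mat_C1] mult.commute)
  finally show ?thesis .
qed

text \<open>Needed ahead of the interpretation of \<open>incidence_quotient\<close>, because the
  verification of its bracket axiom relies on it.\<close>

lemma supported_mat_comm:
  assumes M: "M \<in> arrow_mats" and N: "N \<in> (arrow_mats :: ('a, 'k::field) mat set)"
  shows "mat_comm (arrs Q) M N \<in> arrow_mats"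
proof -
  have "(\<Sum>k\<in>arrs Q. M i k * N k j) = 0"
    if "M \<in> arrow_mats" "N \<in> arrow_mats" "\<not> arrow_le TYPE('k) i j" for M N :: "('a, 'k) mat" and i j
  proof (rule sum.neutral, rule ballI)
    fix k show "M i k * N k j = 0"
      using that arrow_le_trans[of i k j] by (auto simp: supported_def)
  qed
  from this[OF M N] this[OF N M]
  have "mat_comm (arrs Q) M N i j = 0" if "\<not> arrow_le TYPE('k) i j" for i j
    using that by (simp add: mat_comm_def)
  then show ?thesis unfolding supported_def by blast
qed

text \<open>With row \<open>b\<close> and column \<open>a\<close> for the pair (a, b), applying the
  derivation of \<open>M\<close> to column \<open>x\<close> of \<open>N\<close> gives column
  \<open>x\<close> of M N, so neither a transpose nor a sign appears.\<close>

lemma bracket1_of_mat: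
  assumes M: "M \<in> arrow_mats" and N: "N \<in> (arrow_mats :: ('a, 'k::field) mat set)"
  shows "bracket1 Q Z (of_mat M) (of_mat N) = of_mat (mat_comm (arrs Q) M N)"
proof
  fix y :: "'a \<times> ('v, 'a) qpath"
  obtain x q where y: "y = (x, q)" by (cases y)
  have br: "bracket1 Q Z (of_mat M) (of_mat N) y =
    (\<Sum>b\<in>arrs Q. of_mat M (b, q) * N b x) - (\<Sum>b\<in>arrs Q. of_mat N (b, q) * M b x)"
    unfolding y bracket1_der[OF of_mat_C1 of_mat_C1] der_ext_of_mat[OF M N] der_ext_of_mat[OF N M] ..
  show "bracket1 Q Z (of_mat M) (of_mat N) y = of_mat (mat_comm (arrs Q) M N) y"
  proof (cases "\<exists>b. q = arrow_path Q b")
    case True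
    then obtain b where b: "q = arrow_path Q b" by blast
    show ?thesis unfolding br unfolding y b
      by (simp add: of_mat_arrow M N supported_mat_comm) (simp add: mat_comm_def)
  next
    case False
    then have "of_mat X (a, q) = 0" for X :: "('a, 'k) mat" and a by (meson of_mat_support)
    then show ?thesis unfolding br unfolding y by simp
  qed
qed

text \<open>On coefficients at arrows only the values of \<open>W\<close> at vertices count: an
  arrow is scaled by the difference between its two ends.\<close>

lemma inner_arrow:
  assumes "a \<in> arrs Q"
  shows "inner W (a, arrow_path Q b) = (if a = b then W (src Q a, []) - W (tgt Q a, []) else 0)"
proof (cases "a = b")
  case True
  have B': "(src Q a, [a]) \<in> B" using arrow_in_B[OF assms] by (simp add: arrow_path_def)
  have "sandwich (src Q a, []) W (src Q a, [a]) (src Q a, [a]) = W (src Q a, [])"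
    using sandwich_eq[of "(src Q a, [])" "[]" "(src Q a, [a])" W] B' by simp
  moreover have "sandwich (src Q a, [a]) W (tgt Q a, []) (src Q a, [a]) = W (tgt Q a, [])"
    using sandwich_eq[of "(src Q a, [a])" "[]" "(tgt Q a, [])" W] B' by (simp add: arrow_pterm)
  ultimately show ?thesis using True assms by (simp add: inner_def arrow_path_def)
next
  case False
  have "sandwich (src Q a, []) W (src Q a, [a]) (arrow_path Q b) = 0"
    using False by (auto elim!: sandwich_nonzeroE intro: ccontr simp: arrow_path_def)
  moreover have "sandwich (src Q a, [a]) W (tgt Q a, []) (arrow_path Q b) = 0"
    using False by (auto elim!: sandwich_nonzeroE intro: ccontr simp: arrow_path_def)
  ultimately show ?thesis using False assms by (simp add: inner_def)
qed

section \<open>L_0 as an incidence quotient, and the translation of the generators\<close>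

definition cls :: "('a, 'k::field) mat \<Rightarrow> ('a \<times> ('v, 'a) qpath \<Rightarrow> 'k) set" where
  "cls M = coset (ImPsi0 Q Z) (of_mat M)"

text \<open>The axiom \<open>kernel\<close> comes from \<open>inner_arrow\<close>: the diagonal
  entries depend only on the ends of an arrow, which parallel arrows share.\<close>

lemma incidence_quotient_L0:
  "incidence_quotient (L0 Q Z :: ('k::field, _) lie_alg) (arrs Q) (arrow_le TYPE('k)) cls"
proof
  show "finite (arrs Q)" by (rule finA)
  show "arrow_le TYPE('k) i j \<Longrightarrow> i \<in> arrs Q \<and> j \<in> arrs Q" for i j by (simp add: arrow_le_def)
  show "i \<in> arrs Q \<Longrightarrow> arrow_le TYPE('k) i i" for i by (rule arrow_le_refl)
  show "arrow_le TYPE('k) i j \<Longrightarrow> arrow_le TYPE('k) j l \<Longrightarrow> arrow_le TYPE('k) i l" for i j l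
    by (rule arrow_le_trans)
  show "lcarrier (L0 Q Z :: ('k, _) lie_alg) = cls ` arrow_mats"
    unfolding L0_def V0_eq by (auto simp: cls_def)
  have "of_mat (\<lambda>_ _. 0) = (\<lambda>_. 0::'k)" by (auto simp: of_mat_def)
  then show "lzero (L0 Q Z :: ('k, _) lie_alg) = cls (\<lambda>_ _. 0)"
    by (simp add: L0_def cls_def coset_def)
next
  fix M N :: "('a, 'k) mat" and s :: 'k
  assume M: "M \<in> arrow_mats"
  have sc: "of_mat (\<lambda>i j. s * M i j) = (\<lambda>x. s * of_mat M x)" by (auto simp: of_mat_def)
  show "lscale (L0 Q Z) s (cls M) = cls (\<lambda>i j. s * M i j)"
    unfolding cls_def sc L0_def lie_alg.simps
    by (rule coset_scale) (rule ImPsi0_zero, erule (1) ImPsi0_add, erule ImPsi0_scale)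
  assume N: "N \<in> arrow_mats"
  have ad: "of_mat (\<lambda>i j. M i j + N i j) = (\<lambda>x. of_mat M x + of_mat N x)" by (auto simp: of_mat_def)
  show "ladd (L0 Q Z) (cls M) (cls N) = cls (\<lambda>i j. M i j + N i j)"
    unfolding cls_def ad L0_def lie_alg.simps
    by (rule coset_add) (rule ImPsi0_zero, erule (1) ImPsi0_add)
  have "of_mat M \<in> KerPsi1 Q Z" "of_mat N \<in> KerPsi1 Q Z" using of_mat_V0 M N by (auto simp: V0_def)
  from coset_bracket1[OF this]
  show "lbr (L0 Q Z) (cls M) (cls N) = cls (mat_comm (arrs Q) M N)"
    by (simp only: L0_def cls_def lie_alg.simps bracket1_of_mat[OF M N])
next
  fix M :: "('a, 'k) mat"
  assume M: "M \<in> arrow_mats" and "cls M = lzero (L0 Q Z)"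
  then have "coset (ImPsi0 Q Z) (of_mat M) = ImPsi0 Q Z" by (simp add: L0_def cls_def)
  moreover have "of_mat M \<in> coset (ImPsi0 Q Z) (of_mat M)" by (rule cosetI[OF ImPsi0_zero]) simp
  ultimately obtain W where W: "of_mat M = inner W" unfolding ImPsi0_eq by blast
  have e: "M b a = (if a = b then W (src Q a, []) - W (tgt Q a, []) else 0)" if "a \<in> arrs Q" for a b
    using of_mat_arrow[OF M, of a b] inner_arrow[OF that, of W b] W by simp
  have "M i j = 0" if "i \<noteq> j" for i j
  proof (cases "j \<in> arrs Q")
    case True then show ?thesis using e[OF True, of i] that by simp
  next
    case False then show ?thesis using M by (auto simp: supported_def arrow_le_def)
  qed
  moreover have "M i i = M j j" if "arrow_le TYPE('k) i j" for i j
    using e[of i i] e[of j j] that by (simp add: arrow_le_def)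
  ultimately show "(\<forall>i j. i \<noteq> j \<longrightarrow> M i j = 0) \<and> (\<forall>i j. arrow_le TYPE('k) i j \<longrightarrow> M i i = M j j)"
    by blast
qed

lemma basis_el_of_mat:
  assumes "a \<in> arrs Q" "b \<in> arrs Q" "src Q a = src Q b" "tgt Q a = tgt Q b"
  shows "of_mat (unit_mat b a) = basis_el (a, arrow_path Q b)"
proof
  fix y :: "'a \<times> ('v, 'a) qpath"
  obtain x q where y: "y = (x, q)" by (cases y)
  show "of_mat (unit_mat b a) y = basis_el (a, arrow_path Q b) y"
  proof (cases "y \<in> Q1Q1 Q")
    case True
    then obtain b' where b': "q = arrow_path Q b'" unfolding y by (auto simp: Q1Q1_def)
    then show ?thesis using True unfolding y of_mat_def basis_el_def unit_mat_def
      by (auto simp: arrow_path_def)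
  next
    case False
    then show ?thesis using assms Q1Q1_arrow[of a b] by (auto simp: y of_mat_def basis_el_def)
  qed
qed

lemma cls_unit_mat:
  assumes "a \<in> arrs Q" "b \<in> arrs Q" "src Q a = src Q b" "tgt Q a = tgt Q b"
  shows "cls (unit_mat b a) = cls_el Q Z a b"
  unfolding cls_def cls_el_def basis_el_of_mat[OF assms] ..

lemma inL0_iff:
  assumes "a \<in> arrs Q" "b \<in> arrs Q" "src Q a = src Q b" "tgt Q a = tgt Q b"
  shows "inL0 TYPE('k::field) Q Z a b \<longleftrightarrow> leZ TYPE('k) Q Z b a"
proof -
  have m: "(a, arrow_path Q b) \<in> Q1B Q Z" using Q1Q1_sub Q1Q1_arrow[of a b] assms by blast
  have "(\<Sum>u\<in>Q1B Q Z. basis_el (a, arrow_path Q b) u * of_nat (occ_count Q Z p (fst u) (snd u) q)) =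
    (of_nat (occ_count Q Z p a (arrow_path Q b) q) :: 'k)" for p q
  proof -
    have "(\<Sum>u\<in>Q1B Q Z. basis_el (a, arrow_path Q b) u * of_nat (occ_count Q Z p (fst u) (snd u) q)) =
      (\<Sum>u\<in>Q1B Q Z. if u = (a, arrow_path Q b) then (of_nat (occ_count Q Z p a (arrow_path Q b) q) :: 'k) else 0)"
      by (rule sum.cong) (auto simp: basis_el_def)
    then show ?thesis using m finite_Q1B by (simp add: sum.delta)
  qed
  then show ?thesis unfolding inL0_def psi1_def leZ_def by (auto simp: fun_eq_iff)
qed

lemma approx_cls_eq:
  assumes "a \<in> arrs Q" shows "approx_cls TYPE('k::field) Q Z a = block (arrow_le TYPE('k)) a"
  using assms by (auto simp: approx_cls_def block_def arrow_le_def parallel_arrows)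

theorem radical_L0: "lradical (L0 Q Z :: ('k::field, _) lie_alg) (lspan (L0 Q Z) (rad_gens Q Z))"
proof -
  interpret I: incidence_quotient "L0 Q Z :: ('k, _) lie_alg" "arrs Q" "arrow_le TYPE('k)" cls
    by (rule incidence_quotient_L0)
  let ?b = "block (arrow_le TYPE('k))"
  have le: "arrow_le TYPE('k) b a \<longleftrightarrow> a \<in> arrs Q \<and> b \<in> arrs Q \<and> src Q a = src Q b \<and> tgt Q a = tgt Q b
      \<and> inL0 TYPE('k) Q Z a b" for a b
    using inL0_iff[of a b, where 'k = 'k] by (auto simp: arrow_le_def)
  have unit: "cls (unit_mat b a :: ('a, 'k) mat) = cls_el Q Z a b" if "arrow_le TYPE('k) b a" for a b
    using that by (intro cls_unit_mat) (auto simp: le)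
  have in_block: "arrow_le TYPE('k) b a" if "b \<in> ?b a" for a b using that by (simp add: block_def)
  have G1: "cls ` {(\<lambda>p q. \<Sum>b\<in>?b a. unit_mat b b p q) | a. a \<in> arrs Q} =
    {coset (ImPsi0 Q Z) (\<lambda>x. \<Sum>b\<in>approx_cls TYPE('k) Q Z a. basis_el (b, arrow_path Q b) x :: 'k) | a. a \<in> arrs Q}"
  proof -
    have "cls (\<lambda>p q. \<Sum>b\<in>?b a. unit_mat b b p q :: 'k) =
      coset (ImPsi0 Q Z) (\<lambda>x. \<Sum>b\<in>approx_cls TYPE('k) Q Z a. basis_el (b, arrow_path Q b) x)"
      if a: "a \<in> arrs Q" for a
    proof -
      have "of_mat (\<lambda>p q. \<Sum>b\<in>?b a. unit_mat b b p q) = (\<lambda>x. \<Sum>b\<in>?b a. of_mat (unit_mat b b) x :: 'k)"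
        by (rule ext) (simp add: of_mat_def split: prod.split)
      also have "\<dots> = (\<lambda>x. \<Sum>b\<in>?b a. basis_el (b, arrow_path Q b) x)"
        using I.block_in by (intro ext sum.cong refl) (simp add: basis_el_of_mat subset_iff)
      finally show ?thesis unfolding cls_def approx_cls_eq[OF a] by simp
    qed
    then show ?thesis by (auto simp: image_iff)
  qed
  have G2: "cls ` {unit_mat i j | i j. arrow_le TYPE('k) i j \<and> \<not> arrow_le TYPE('k) j i} =
    ({cls_el Q Z ai aj | ai aj. ai \<in> arrs Q \<and> aj \<in> arrs Q \<and> ai \<noteq> aj \<and>
        parallel Q (arrow_path Q ai) (arrow_path Q aj) \<and>
        inL0 TYPE('k) Q Z ai aj \<and> \<not> inL0 TYPE('k) Q Z aj ai} :: (_ \<Rightarrow> 'k) set set)" (is "cls ` ?L = ?R")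
  proof (intro equalityI subsetI)
    fix x assume "x \<in> cls ` ?L"
    then obtain i j where ij: "x = cls (unit_mat i j)" "arrow_le TYPE('k) i j" "\<not> arrow_le TYPE('k) j i" by blast
    then have "x = cls_el Q Z j i" "i \<noteq> j" using unit by auto
    then show "x \<in> ?R" using ij(2,3) by (auto simp: le parallel_arrows)
  next
    fix x assume "x \<in> ?R"
    then obtain i j where "x = cls_el Q Z j i" "arrow_le TYPE('k) i j" "\<not> arrow_le TYPE('k) j i"
      by (auto simp: le parallel_arrows)
    then show "x \<in> cls ` ?L" using unit[of i j] by force
  qed
  \<comment> \<open>The statement lists (a, b) and (a, a) for an ordered pair; letting
    \<open>a\<close> run through both members of the class yields all four units of the
    block.\<close>
  have G3: "cls ` {unit_mat i j | i j. I.exceptional i \<and> j \<in> ?b i} =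
    (if CHAR('k) = 2 then
        {cls_el Q Z a b | a b. a \<in> arrs Q \<and> b \<in> arrs Q \<and> a \<noteq> b \<and>
           approx_cls TYPE('k) Q Z a = {a, b}}
      \<union> {cls_el Q Z a a | a b. a \<in> arrs Q \<and> b \<in> arrs Q \<and> a \<noteq> b \<and>
           approx_cls TYPE('k) Q Z a = {a, b}}
      else {} :: (_ \<Rightarrow> 'k) set set)" (is "cls ` ?L = ?R")
  proof (intro equalityI subsetI)
    fix x assume "x \<in> cls ` ?L"
    then obtain i j where x: "x = cls (unit_mat i j)" and i: "I.exceptional i" and j: "j \<in> ?b i" by blast
    have ch: "CHAR('k) = 2" and "card (?b i) = 2" using i by (auto simp: I.exceptional_def)
    moreover have bj: "?b j = ?b i" "j \<in> ?b j" "i \<in> ?b i"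
      using I.block_eq[OF j] j I.block_sym[OF j] by auto
    ultimately obtain u v where uv: "?b j = {u, v}" "u \<noteq> v" by (auto simp: card_2_iff)
    obtain k where k: "?b j = {j, k}" "k \<noteq> j"
    proof (cases "j = u")
      case True then show thesis using that[of v] uv by auto
    next
      case False then show thesis using that[of u] uv bj(2) by auto
    qed
    have A: "i \<in> arrs Q" "j \<in> arrs Q" "k \<in> arrs Q" using I.block_in bj k by blast+
    have x': "x = cls_el Q Z j i" using x unit in_block[OF I.block_sym[OF j]] by simp
    have "i = j \<or> i = k" using bj k by auto
    then show "x \<in> ?R"
      unfolding if_P[OF ch] using x' A k approx_cls_eq[OF A(2), where 'k = 'k] by blast
  next
    fix x assume x: "x \<in> ?R"
    then have ch: "CHAR('k) = 2" by (auto split: if_splits)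
    obtain a b i where ab: "x = cls_el Q Z a i" "a \<in> arrs Q" "b \<in> arrs Q" "a \<noteq> b" "?b a = {a, b}" "i \<in> {a, b}"
      using x unfolding if_P[OF ch] by (auto simp: approx_cls_eq)
    have i: "i \<in> ?b a" using ab by simp
    have "?b i = {a, b}" using I.block_eq[OF i] ab by simp
    then have "I.exceptional i" using ch ab(4) by (simp add: I.exceptional_def)
    moreover have "a \<in> ?b i" using \<open>?b i = {a, b}\<close> by simp
    moreover have "x = cls (unit_mat i a)" using ab(1) unit in_block[OF i] by simp
    ultimately show "x \<in> cls ` ?L" by blast
  qed
  have "cls ` I.gens = (rad_gens Q Z :: (_ \<Rightarrow> 'k) set set)"
    unfolding I.gens_def rad_gens_def image_Un G1 G2 G3 ..
  then show ?thesis using I.radical by simp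
qed

end

theorem theorem3p10:
  fixes Q :: "('v, 'a) quiver" and Z :: "('v, 'a) qpath set"
  assumes "finite_quiver Q" and "connected_quiver Q"
    and "minimal_relations Q Z"
    and "finite (Bpaths Q Z)"
  shows "lradical (L0 Q Z :: ('k::alg_closed_field, _) lie_alg) (lspan (L0 Q Z) (rad_gens Q Z))"
proof -
  interpret monomial_quiver Q Z using assms by unfold_locales
  show ?thesis by (rule radical_L0)
qed

end
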